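(* Every $AW^\ast$-algebra of type $I_f$ (in particular, every von Neumann algebra of type $I_f$) is almost $\ast$-clean. If it is also von Neumann regular as a ring, then it is $\ast$-clean.
   Context: A projection in a $\ast$-ring is an element $p$ with $p^\ast=p=p^2$. A Baer $\ast$-ring is a unital $\ast$-ring in which the right annihilator of every nonempty subset is generated, as a right ideal, by a projection. An $AW^\ast$-algebra is a (complex) $C^\ast$-algebra that is a Baer $\ast$-ring; every von Neumann algebra is an $AW^\ast$-algebra. A ring is abelian if all its idempotents are central. A projection $p$ of $R$ is abelian if the ring $pRp$ is abelian; it is faithful if there is no nonzero central idempotent $e$ with $ep=0$. A Baer $\ast$-ring is finite if $x^\ast x=1$ implies $xx^\ast=1$; it is of type $I$ if it has a faithful abelian projection; it is of type $I_f$ if it is of type $I$ and finite. An element of a ring is regular if it is neither a left nor a right zero-divisor. A $\ast$-ring is $\ast$-clean (resp. almost $\ast$-clean) if every element is the sum of a unit (resp. a regular element) and a projection. *)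

theory Defs
  imports "HOL-Analysis.Analysis"
begin

section \<open>Unital star-rings\<close>

text \<open>The condition 0 \<noteq> 1 is not imposed, so the zero ring is included; this is why the class
  extends \<^class>\<open>ring\<close> and \<^class>\<open>monoid_mult\<close> instead of \<^class>\<open>ring_1\<close>.\<close>

class star_ring = ring + monoid_mult +
  fixes star :: "'a \<Rightarrow> 'a"
  assumes star_star: "star (star x) = x"
    and star_add: "star (x + y) = star x + star y"
    and star_mult: "star (x * y) = star y * star x"

definition projection :: "'a::star_ring \<Rightarrow> bool" where
  "projection p \<longleftrightarrow> star p = p \<and> p * p = p"

definition right_annihilator :: "'a::star_ring set \<Rightarrow> 'a set" where
  "right_annihilator S = {x. \<forall>s\<in>S. s * x = 0}"

definition baer_star_ring :: "'a::star_ring itself \<Rightarrow> bool" where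
  "baer_star_ring _ \<longleftrightarrow>
     (\<forall>S :: 'a set. S \<noteq> {} \<longrightarrow> (\<exists>p. projection p \<and> right_annihilator S = range (\<lambda>x. p * x)))"

text \<open>Stated for a multiplicatively closed subset so that it applies to a corner, which is a ring
  with its own unit.\<close>

definition abelian_ring_on :: "'a::star_ring set \<Rightarrow> bool" where
  "abelian_ring_on R \<longleftrightarrow> (\<forall>e\<in>R. e * e = e \<longrightarrow> (\<forall>x\<in>R. e * x = x * e))"

definition corner :: "'a::star_ring \<Rightarrow> 'a set" where
  "corner p = range (\<lambda>x. p * x * p)"

definition abelian_projection :: "'a::star_ring \<Rightarrow> bool" where
  "abelian_projection p \<longleftrightarrow> projection p \<and> abelian_ring_on (corner p)"

definition central_idempotent :: "'a::star_ring \<Rightarrow> bool" where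
  "central_idempotent e \<longleftrightarrow> e * e = e \<and> (\<forall>x. e * x = x * e)"

definition faithful_projection :: "'a::star_ring \<Rightarrow> bool" where
  "faithful_projection p \<longleftrightarrow>
     projection p \<and> \<not> (\<exists>e. e \<noteq> 0 \<and> central_idempotent e \<and> e * p = 0)"

definition star_finite :: "'a::star_ring itself \<Rightarrow> bool" where
  "star_finite _ \<longleftrightarrow> (\<forall>x :: 'a. star x * x = 1 \<longrightarrow> x * star x = 1)"

definition type_I :: "'a::star_ring itself \<Rightarrow> bool" where
  "type_I _ \<longleftrightarrow> (\<exists>p :: 'a. faithful_projection p \<and> abelian_projection p)"

definition type_I_f :: "'a::star_ring itself \<Rightarrow> bool" where
  "type_I_f T \<longleftrightarrow> type_I T \<and> star_finite T"

definition unit_element :: "'a::star_ring \<Rightarrow> bool" where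
  "unit_element u \<longleftrightarrow> (\<exists>v. u * v = 1 \<and> v * u = 1)"

definition regular_element :: "'a::star_ring \<Rightarrow> bool" where
  "regular_element u \<longleftrightarrow> (\<forall>y. u * y = 0 \<longrightarrow> y = 0) \<and> (\<forall>y. y * u = 0 \<longrightarrow> y = 0)"

definition star_clean :: "'a::star_ring itself \<Rightarrow> bool" where
  "star_clean _ \<longleftrightarrow> (\<forall>x :: 'a. \<exists>u p. unit_element u \<and> projection p \<and> x = u + p)"

definition almost_star_clean :: "'a::star_ring itself \<Rightarrow> bool" where
  "almost_star_clean _ \<longleftrightarrow> (\<forall>x :: 'a. \<exists>u p. regular_element u \<and> projection p \<and> x = u + p)"

definition von_neumann_regular :: "'a::star_ring itself \<Rightarrow> bool" where
  "von_neumann_regular _ \<longleftrightarrow> (\<forall>x :: 'a. \<exists>y. x * y * x = x)"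


section \<open>Complex normed spaces, C*-algebras and AW*-algebras\<close>

class complex_normed_vector = real_normed_vector +
  fixes scaleC :: "complex \<Rightarrow> 'a \<Rightarrow> 'a"
  assumes scaleC_of_real: "scaleC (complex_of_real r) x = r *\<^sub>R x"
    and scaleC_add_right: "scaleC c (x + y) = scaleC c x + scaleC c y"
    and scaleC_add_left: "scaleC (c + d) x = scaleC c x + scaleC d x"
    and scaleC_scaleC: "scaleC c (scaleC d x) = scaleC (c * d) x"
    and norm_scaleC: "norm (scaleC c x) = cmod c * norm x"

text \<open>For a nonzero algebra the axioms imply that the unit has norm 1.\<close>

class cstar_algebra = star_ring + complex_normed_vector + real_normed_algebra + complete_space +
  assumes mult_scaleC_left: "scaleC c x * y = scaleC c (x * y)"
    and mult_scaleC_right: "x * scaleC c y = scaleC c (x * y)"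
    and star_scaleC: "star (scaleC c x) = scaleC (cnj c) (star x)"
    and cstar_identity: "norm (star x * x) = (norm x)\<^sup>2"

definition aw_star_algebra :: "'a::cstar_algebra itself \<Rightarrow> bool" where
  "aw_star_algebra T \<longleftrightarrow> baer_star_ring T"


section \<open>Von Neumann algebras\<close>

class complex_hilbert_space = complex_normed_vector + complete_space +
  fixes cinner :: "'a \<Rightarrow> 'a \<Rightarrow> complex"
  assumes cinner_commute: "cinner x y = cnj (cinner y x)"
    and cinner_add_left: "cinner (x + y) z = cinner x z + cinner y z"
    and cinner_scaleC_left: "cinner (scaleC c x) y = cnj c * cinner x y"
    and cinner_self: "cinner x x = complex_of_real ((norm x)\<^sup>2)"

definition bounded_operators :: "('h::complex_hilbert_space \<Rightarrow> 'h) set" where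
  "bounded_operators = {T. bounded_linear T \<and> (\<forall>c v. T (scaleC c v) = scaleC c (T v))}"

definition adjoint_operators ::
  "('h::complex_hilbert_space \<Rightarrow> 'h) \<Rightarrow> ('h \<Rightarrow> 'h) \<Rightarrow> bool" where
  "adjoint_operators S T \<longleftrightarrow> (\<forall>v w. cinner (S v) w = cinner v (T w))"

definition commutant ::
  "('h::complex_hilbert_space \<Rightarrow> 'h) set \<Rightarrow> ('h \<Rightarrow> 'h) set" where
  "commutant M = {T \<in> bounded_operators. \<forall>S\<in>M. T \<circ> S = S \<circ> T}"

text \<open>A set of operators equal to its own double commutant automatically consists of bounded
  operators and is a unital subalgebra.\<close>

definition von_neumann_algebra_on :: "('h::complex_hilbert_space \<Rightarrow> 'h) set \<Rightarrow> bool" where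
  "von_neumann_algebra_on M \<longleftrightarrow>
     (\<forall>S\<in>M. \<exists>T\<in>M. adjoint_operators S T) \<and> commutant (commutant M) = M"

definition star_isomorphism_onto ::
  "('a::cstar_algebra \<Rightarrow> 'h::complex_hilbert_space \<Rightarrow> 'h) \<Rightarrow> ('h \<Rightarrow> 'h) set \<Rightarrow> bool" where
  "star_isomorphism_onto \<pi> M \<longleftrightarrow>
     bij_betw \<pi> UNIV M \<and>
     \<pi> 1 = id \<and>
     (\<forall>x y. \<pi> (x + y) = (\<lambda>v. \<pi> x v + \<pi> y v)) \<and>
     (\<forall>c x. \<pi> (scaleC c x) = (\<lambda>v. scaleC c (\<pi> x v))) \<and>
     (\<forall>x y. \<pi> (x * y) = \<pi> x \<circ> \<pi> y) \<and>
     (\<forall>x. adjoint_operators (\<pi> x) (\<pi> (star x)))"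

text \<open>The algebra \<open>'a\<close> is, up to star-isomorphism, a von Neumann algebra of operators on \<open>'h\<close>.
  No isometry condition is needed: star-isomorphisms of C*-algebras are isometric.\<close>

definition von_neumann_algebra ::
  "'h::complex_hilbert_space itself \<Rightarrow> 'a::cstar_algebra itself \<Rightarrow> bool" where
  "von_neumann_algebra _ _ \<longleftrightarrow>
     (\<exists>(M :: ('h \<Rightarrow> 'h) set) (\<pi> :: 'a \<Rightarrow> 'h \<Rightarrow> 'h).
        von_neumann_algebra_on M \<and> star_isomorphism_onto \<pi> M)"

end

theory Submission
  imports Defs
begin

text \<open>
  Let \<open>A\<close> be an \<open>AW\<^sup>*\<close>-algebra of type \<open>I\<^sub>f\<close> and \<open>e\<close> a faithful abelian projection.  Over suitable
  nonzero central projections \<open>z\<close>, which exhaust \<open>1\<close>, the algebra \<open>z A\<close> consists of the \<open>n\<close> by \<open>n\<close>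
  matrices over the commutative algebra \<open>z e A e\<close>, with \<open>n\<close> depending on \<open>z\<close>.  For a matrix \<open>x\<close> over a field, \<open>det (x - D)\<close> is an
  affine function of each entry of the diagonal matrix \<open>D\<close>, with leading term plus or minus the product of
  these entries; so it does not vanish for all \<open>D\<close> with entries \<open>0\<close> and \<open>1\<close>, and such a \<open>D\<close> is a
  projection.  Over the center the choice of the entries varies from place to place, and is made by
  central projections.

  The proof uses this idea without determinants.  The entries of \<open>D\<close> are chosen one after the other, and
  \<open>injective_compression_extend\<close> is the statement that of the two values of the next entry one
  preserves injectivity of the compression, where central projections separate the places at which the
  one or the other is taken.  Injectivity of \<open>b\<close> only says that \<open>b\<close> is not a left zero-divisor.  In a
  matrix algebra this suffices for regularity, and \<open>matrix_frame_injective_left\<close> proves it by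
  Gram-Schmidt orthogonalization of the columns of \<open>b\<close> and finiteness.  Finally the projections found over
  an orthogonal family of central projections are joined by their supremum
  (\<open>aw_star_type_I_f_almost_star_clean\<close>).

  The matrix structure comes from \<open>matrix_frame_exists\<close>: copies of \<open>w e\<close> are split off as long as there
  is room, and infinitely many would contradict finiteness.  This requires sums of infinitely many
  orthogonal partial isometries, which \<open>glue_partial_isometries\<close> obtains from the supremum of the
  projections onto their graphs.

  The analysis consists of square roots of positive elements, obtained as limits of polynomials, and of
  three consequences for an abelian projection \<open>e\<close>: \<open>e A e\<close> is commutative
  (\<open>abelian_corner_commute\<close>), an element \<open>x = x e \<noteq> 0\<close> can be multiplied to a nonzero partial isometry
  (\<open>abelian_local_partial_isometry\<close>), and its initial projection is the part of \<open>e\<close> over a central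
  projection (\<open>abelian_subprojection_central\<close>).

  In a von Neumann regular ring a regular element is a unit, so that almost star-clean implies
  star-clean.  A von Neumann algebra is an \<open>AW\<^sup>*\<close>-algebra because the projection onto the common kernel
  of a set of operators in it lies in the double commutant (\<open>von_neumann_algebra_baer\<close>).
\<close>

section \<open>Supports and central covers in Baer star-rings\<close>

lemma star_zero [simp]: "star (0::'a::star_ring) = 0"
proof -
  have "star (0::'a) + star 0 = star 0 + 0"
    by (simp flip: star_add)
  then show ?thesis by (metis add_left_cancel)
qed

lemma star_one [simp]: "star (1::'a::star_ring) = 1"
  by (metis mult_1 mult_1_right star_mult star_star)

lemma star_uminus: "star (- x) = - star (x::'a::star_ring)"
  by (metis add.right_inverse minus_unique star_add star_zero)

lemma star_diff: "star (x - y) = star x - star (y::'a::star_ring)"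
  by (simp add: diff_conv_add_uminus star_add star_uminus del: add_uminus_conv_diff)

lemma star_sum: "star (sum f I) = (\<Sum>i\<in>I. star (f i))" for f :: "'b \<Rightarrow> 'a::star_ring"
  by (induction I rule: infinite_finite_induct) (auto simp: star_add)

lemma projection_star: "projection p \<Longrightarrow> star p = p"
  and projection_idem: "projection p \<Longrightarrow> p * p = p"
  by (auto simp: projection_def)

lemma projection_idem_left: "projection p \<Longrightarrow> p * (p * x) = p * x"
  by (metis mult.assoc projection_idem)

lemma projection_complement: "projection p \<Longrightarrow> projection (1 - p)"
  by (simp add: projection_def star_diff algebra_simps)

lemma projection_orthogonal_sym:
  assumes "projection p" "projection q" "p * q = 0" shows "q * p = 0"
  by (metis assms projection_star star_mult star_zero)

lemma projection_below_sym:
  assumes "projection p" "projection q" "p * q = q" shows "q * p = q"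
  by (metis assms projection_star star_mult)

definition central_projection :: "'a::star_ring \<Rightarrow> bool" where
  "central_projection c \<longleftrightarrow> projection c \<and> (\<forall>x. c * x = x * c)"

lemma central_projection_commute: "central_projection c \<Longrightarrow> x * c = c * x"
  and central_projection_projection: "central_projection c \<Longrightarrow> projection c"
  by (auto simp: central_projection_def)

lemma projection_central_mult:
  assumes "central_projection c" "projection p"
  shows "projection (c * p)"
  unfolding projection_def
proof
  have comm: "p * c = c * p" using assms(1) by (simp add: central_projection_commute)
  then show "star (c * p) = c * p"
    using projection_star[OF assms(2)] projection_star[OF central_projection_projection[OF assms(1)]]
    by (simp add: star_mult)
  have "c * p * (c * p) = c * (p * c) * p" by (simp only: mult.assoc)
  also have "\<dots> = (c * c) * (p * p)" unfolding comm by (simp only: mult.assoc)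
  finally show "c * p * (c * p) = c * p"
    using assms by (simp add: projection_idem central_projection_projection)
qed

lemma central_projection_mult:
  assumes "central_projection c" "central_projection d"
  shows "central_projection (c * d)"
  unfolding central_projection_def
proof (intro conjI allI)
  show "projection (c * d)"
    by (rule projection_central_mult[OF assms(1) central_projection_projection[OF assms(2)]])
  show "c * d * x = x * (c * d)" for x
  proof -
    have "c * d * x = c * x * d"
      using central_projection_commute[OF assms(2), of x] by (simp add: mult.assoc)
    also have "c * x * d = x * (c * d)"
      using central_projection_commute[OF assms(1), of x] by (simp add: mult.assoc[symmetric])
    finally show ?thesis .
  qed
qed

lemma central_projection_complement: "central_projection c \<Longrightarrow> central_projection (1 - c)"
  by (simp add: central_projection_def projection_complement algebra_simps)

lemma central_projection_diff:
  assumes "central_projection w" "central_projection s" "w * s = s"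
  shows "central_projection (w - s)"
proof -
  have "w * (1 - s) = w - s" by (simp only: right_diff_distrib mult_1_right assms(3))
  then show ?thesis
    using central_projection_mult[OF assms(1) central_projection_complement[OF assms(2)]]
    by (simp only:)
qed

text \<open>The projection \<open>h\<close> is the complement of the one that generates the right annihilator of
  \<open>S\<close>.  For \<open>S = {x}\<close> it is the right support of \<open>x\<close>, and for a set of projections it is their
  supremum; in this form both are characterized by the elements that they annihilate.\<close>

lemma baer_support:
  assumes "baer_star_ring TYPE('a::star_ring)"
  obtains h :: "'a::star_ring" where "projection h" "\<And>y. h * y = 0 \<longleftrightarrow> (\<forall>s\<in>S. s * y = 0)"
proof -
  obtain p :: 'a where p: "projection p" and ann: "right_annihilator (insert 0 S) = range (\<lambda>x. p * x)"
    using assms[unfolded baer_star_ring_def, rule_format, of "insert 0 S"] insert_not_empty by metis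
  have "(1 - p) * y = 0 \<longleftrightarrow> (\<forall>s\<in>S. s * y = 0)" for y
  proof -
    have "(1 - p) * y = 0 \<longleftrightarrow> y = p * y" by (simp only: left_diff_distrib mult_1 right_minus_eq)
    also have "\<dots> \<longleftrightarrow> y \<in> range (\<lambda>x. p * x)"
    proof
      assume "y \<in> range (\<lambda>x. p * x)"
      then obtain x where "y = p * x" by blast
      then show "y = p * y" by (simp add: projection_idem_left[OF p])
    qed (rule range_eqI)
    also have "\<dots> \<longleftrightarrow> (\<forall>s\<in>S. s * y = 0)"
      by (simp add: ann[symmetric] right_annihilator_def)
    finally show ?thesis .
  qed
  then show ?thesis by (rule that[OF projection_complement[OF p]])
qed

lemma support_absorb:
  assumes "projection h" "\<And>y. h * y = 0 \<longleftrightarrow> (\<forall>s\<in>S. s * y = 0)" "s \<in> S"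
  shows "s * h = s"
proof -
  have "h * (1 - h) = 0" using assms(1) by (simp add: algebra_simps projection_idem)
  then have "s * (1 - h) = 0" using assms(2,3) by blast
  then show ?thesis by (simp add: algebra_simps)
qed

text \<open>If the right annihilator of \<open>S\<close> is also a left ideal, then \<open>c a (1 - c) = 0\<close> for all \<open>a\<close>,
  and the adjoint of this equation gives the other half of centrality.\<close>

lemma baer_central_support:
  assumes "baer_star_ring TYPE('a::star_ring)"
    and ideal: "\<And>a y. \<forall>s\<in>S. s * y = 0 \<Longrightarrow> \<forall>s\<in>S. s * (a * y) = 0"
  obtains c :: "'a::star_ring" where "central_projection c" "\<And>y. c * y = 0 \<longleftrightarrow> (\<forall>s\<in>S. s * y = 0)"
proof -
  obtain c :: 'a where c: "projection c" and sup: "\<And>y. c * y = 0 \<longleftrightarrow> (\<forall>s\<in>S. s * y = 0)"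
    using baer_support[OF assms(1)] by blast
  have cac: "c * a = c * a * c" for a
  proof -
    have "c * (1 - c) = 0" using c by (simp add: algebra_simps projection_idem)
    then have "c * (a * (1 - c)) = 0" using sup ideal by blast
    then have "c * a - c * a * c = 0" by (simp only: right_diff_distrib mult_1_right mult.assoc)
    then show ?thesis by simp
  qed
  have "a * c = c * a * c" for a
  proof -
    have "star (c * star a) = star (c * star a * c)" by (rule arg_cong[OF cac])
    then show ?thesis using projection_star[OF c] by (simp add: star_mult star_star mult.assoc)
  qed
  then have "c * a = a * c" for a by (rule trans[OF cac sym])
  then have "central_projection c" using c unfolding central_projection_def by blast
  then show ?thesis using sup that by blast
qed

lemma baer_central_cover:
  assumes "baer_star_ring TYPE('a::star_ring)"
  obtains c :: "'a::star_ring" where "central_projection c" "\<And>y. c * y = 0 \<longleftrightarrow> (\<forall>a. x * a * y = 0)"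
    "c * x = x"
proof -
  obtain c :: 'a where c: "central_projection c" "\<And>y. c * y = 0 \<longleftrightarrow> (\<forall>s\<in>range (\<lambda>a. x * a). s * y = 0)"
  proof (rule baer_central_support[OF assms, of "range (\<lambda>a. x * a)"], goal_cases)
    case (1 a y)
    have "x * b * (a * y) = x * (b * a) * y" for b by (simp add: mult.assoc)
    then show ?case using 1 by simp
  qed blast
  have *: "c * y = 0 \<longleftrightarrow> (\<forall>a. x * a * y = 0)" for y
    using c(2) by auto
  have "c * (1 - c) = 0"
    using projection_idem[OF central_projection_projection[OF c(1)]] by (simp add: right_diff_distrib)
  then have "x * 1 * (1 - c) = 0" using * by blast
  then have "c * x = x"
    using central_projection_commute[OF c(1), of x] by (simp add: right_diff_distrib)
  then show ?thesis by (rule that[OF c(1) *])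
qed

text \<open>An orthogonal family that is maximal among those with property \<open>P\<close> must exhaust \<open>w\<close>, since
  otherwise a member could be added below the complement of its supremum.\<close>

lemma baer_exhaust_central:
  assumes baer: "baer_star_ring TYPE('a::star_ring)" and w: "central_projection (w::'a)"
    and dense: "\<And>y. central_projection y \<Longrightarrow> y \<noteq> 0 \<Longrightarrow> w * y = y \<Longrightarrow>
      \<exists>y'. central_projection y' \<and> y' \<noteq> 0 \<and> y * y' = y' \<and> P y'"
  obtains Y where "\<And>y. y \<in> Y \<Longrightarrow> central_projection y \<and> w * y = y \<and> P y"
    "\<And>y y'. y \<in> Y \<Longrightarrow> y' \<in> Y \<Longrightarrow> y \<noteq> y' \<Longrightarrow> y * y' = 0"
    "\<And>x. w * x = 0 \<longleftrightarrow> (\<forall>y\<in>Y. y * x = 0)"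
proof -
  define good where "good y \<longleftrightarrow> central_projection y \<and> y \<noteq> 0 \<and> w * y = y \<and> P y" for y
  define \<F> where "\<F> = {Y. (\<forall>y\<in>Y. good y) \<and> (\<forall>y\<in>Y. \<forall>y'\<in>Y. y \<noteq> y' \<longrightarrow> y * y' = 0)}"
  have "\<exists>M\<in>\<F>. \<forall>X\<in>\<F>. M \<subseteq> X \<longrightarrow> X = M"
  proof (rule subset_Zorn', goal_cases)
    case (1 C)
    then have chain: "\<And>X X'. X \<in> C \<Longrightarrow> X' \<in> C \<Longrightarrow> X \<subseteq> X' \<or> X' \<subseteq> X" and sub: "C \<subseteq> \<F>"
      by (auto simp: subset_chain_def)
    have "good y" if "y \<in> \<Union>C" for y
      using that sub unfolding \<F>_def by blast
    moreover have "y * y' = 0" if mem: "y \<in> \<Union>C" "y' \<in> \<Union>C" and neq: "y \<noteq> y'" for y y'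
    proof -
      obtain X1 X2 where "X1 \<in> C" "y \<in> X1" "X2 \<in> C" "y' \<in> X2" using mem by blast
      then obtain X where "X \<in> C" "y \<in> X" "y' \<in> X" using chain[of X1 X2] by blast
      then show ?thesis using neq sub unfolding \<F>_def by blast
    qed
    ultimately show ?case unfolding \<F>_def by blast
  qed
  then obtain Y where Y: "Y \<in> \<F>" and max: "\<And>X. X \<in> \<F> \<Longrightarrow> Y \<subseteq> X \<Longrightarrow> X = Y" by blast
  have good: "good y" if "y \<in> Y" for y using Y that unfolding \<F>_def by blast
  obtain s :: 'a where s: "central_projection s" and sup: "\<And>x. s * x = 0 \<longleftrightarrow> (\<forall>y\<in>Y. y * x = 0)"
  proof (rule baer_central_support[OF baer, of Y], goal_cases)
    case (1 a y)
    have "b * (a * y) = a * (b * y)" if "b \<in> Y" for b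
    proof -
      have "a * b = b * a"
        using good[OF that] central_projection_commute[of b a] unfolding good_def by blast
      then have "b * a * y = a * b * y" by simp
      then show ?thesis by (simp only: mult.assoc)
    qed
    then show ?case using 1 by simp
  qed blast
  have ws: "w * s = s"
  proof -
    have "y * (1 - w) = 0" if "y \<in> Y" for y
      using good[OF that] central_projection_commute[OF w, of y] unfolding good_def
      by (simp add: right_diff_distrib)
    then have "s * (1 - w) = 0" using sup by blast
    then show ?thesis
      using central_projection_commute[OF w, of s] by (simp add: right_diff_distrib)
  qed
  have "w - s = 0"
  proof (rule ccontr)
    assume "w - s \<noteq> 0"
    moreover have ws_central: "central_projection (w - s)"
      by (rule central_projection_diff[OF w s ws])
    moreover have ww: "w * w = w" and ss: "s * s = s"
      by (rule projection_idem, rule central_projection_projection, fact)+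
    then have "w * (w - s) = w - s" using ws by (simp add: right_diff_distrib)
    ultimately obtain y' where y': "central_projection y'" "y' \<noteq> 0" "(w - s) * y' = y'" "P y'"
      using dense by blast
    have "s * (w - s) = 0"
      using ws ss central_projection_commute[OF w, of s] by (simp add: right_diff_distrib)
    then have "s * ((w - s) * y') = 0" by (simp flip: mult.assoc)
    then have sy: "s * y' = 0" using y'(3) by simp
    have wy: "w * y' = y'" using y'(3) sy by (simp add: left_diff_distrib)
    have orth: "y * y' = 0" if "y \<in> Y" for y using sy sup that by blast
    have orth': "y' * y = 0" if "y \<in> Y" for y
      using orth[OF that] central_projection_commute[OF y'(1), of y] by simp
    have "good y'" using y' wy unfolding good_def by blast
    moreover have "y * y'' = 0" if "y \<in> Y" "y'' \<in> Y" "y \<noteq> y''" for y y''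
      using Y that unfolding \<F>_def by blast
    ultimately have "insert y' Y \<in> \<F>"
      unfolding \<F>_def using orth orth' good by blast
    then have "y' \<in> Y" using max by blast
    then have "y' * y' = 0" using orth by blast
    then show False using y' projection_idem[OF central_projection_projection[OF y'(1)]] by simp
  qed
  then have "w = s" by simp
  then have exhausts: "w * x = 0 \<longleftrightarrow> (\<forall>y\<in>Y. y * x = 0)" for x using sup by simp
  have orthogonal: "y * y' = 0" if "y \<in> Y" "y' \<in> Y" "y \<noteq> y'" for y y'
    using Y that unfolding \<F>_def by blast
  have member: "central_projection y \<and> w * y = y \<and> P y" if "y \<in> Y" for y
    using good[OF that] unfolding good_def by blast
  show ?thesis by (rule that[OF member orthogonal exhausts])
qed

section \<open>Square roots and positivity in a C*-algebra\<close>

instance cstar_algebra \<subseteq> banach ..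

context
  fixes x :: "'a::cstar_algebra"
begin

lemma star_scaleR: "star (r *\<^sub>R x) = r *\<^sub>R star x"
  by (metis complex_cnj_complex_of_real scaleC_of_real star_scaleC)

lemma norm_star: "norm (star x) = norm x"
proof -
  have "norm x \<le> norm (star x)" for x :: 'a
  proof (cases "x = 0")
    case False
    have "norm x * norm x \<le> norm (star x) * norm x"
      using norm_mult_ineq[of "star x" x] by (simp add: cstar_identity power2_eq_square)
    then show ?thesis using False by simp
  qed simp
  from this[of x] this[of "star x"] show ?thesis by (simp add: star_star)
qed

lemma star_mult_self_eq_zero: "star x * x = 0 \<longleftrightarrow> x = 0"
  using cstar_identity[of x] by auto

lemma norm_self_adjoint_square: "star x = x \<Longrightarrow> norm (x * x) = norm x * norm x"
  using cstar_identity[of x] by (simp add: power2_eq_square)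

lemma norm_projection_le_one: "projection x \<Longrightarrow> norm x \<le> 1"
  using norm_self_adjoint_square by (auto simp: projection_def)

end

lemma norm_one_le_one: "norm (1::'a::cstar_algebra) \<le> 1"
  by (simp add: norm_projection_le_one projection_def)

lemma bounded_linear_star: "bounded_linear (star :: 'a::cstar_algebra \<Rightarrow> 'a)"
  by (rule bounded_linear_intro[of _ 1]) (auto simp: star_add star_scaleR norm_star)

primrec sqrt_iterate :: "'a::real_normed_algebra \<Rightarrow> nat \<Rightarrow> 'a" where
  "sqrt_iterate y 0 = 0"
| "sqrt_iterate y (Suc n) = (1/2) *\<^sub>R (y + sqrt_iterate y n * sqrt_iterate y n)"

lemma sqrt_iterate_one: "0 \<le> sqrt_iterate (1::real) n \<and> sqrt_iterate (1::real) n \<le> 1"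
proof (induction n)
  case (Suc n)
  then have "sqrt_iterate (1::real) n * sqrt_iterate 1 n \<le> 1" by (simp add: mult_le_one)
  then show ?case using Suc by simp
qed simp

lemma sqrt_iterate_commute: "x * y = y * x \<Longrightarrow> x * sqrt_iterate y n = sqrt_iterate y n * x"
  by (induction n) (simp_all add: algebra_simps, metis mult.assoc)

lemma norm_sqrt_iterate:
  fixes y :: "'a::real_normed_algebra"
  assumes "norm y \<le> 1"
  shows "norm (sqrt_iterate y n) \<le> sqrt_iterate 1 n"
proof (induction n)
  case (Suc n)
  have "norm (sqrt_iterate y n * sqrt_iterate y n) \<le> norm (sqrt_iterate y n) * norm (sqrt_iterate y n)"
    by (rule norm_mult_ineq)
  also have "\<dots> \<le> sqrt_iterate 1 n * sqrt_iterate 1 n"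
    using Suc by (simp add: mult_mono')
  finally have "norm (y + sqrt_iterate y n * sqrt_iterate y n) \<le> 1 + sqrt_iterate 1 n * sqrt_iterate 1 n"
    using assms norm_triangle_ineq[of y "sqrt_iterate y n * sqrt_iterate y n"] by linarith
  then show ?case by simp
qed simp

text \<open>The iterates are polynomials in \<open>y\<close> with nonnegative coefficients, and so are their
  differences; this is why the scalar iterates at \<open>1\<close> dominate both.\<close>

lemma norm_sqrt_iterate_step:
  fixes y :: "'a::real_normed_algebra"
  assumes "norm y \<le> 1"
  shows "norm (sqrt_iterate y (Suc n) - sqrt_iterate y n) \<le> sqrt_iterate 1 (Suc n) - sqrt_iterate 1 n"
proof (induction n)
  case 0
  then show ?case using assms by simp
next
  case (Suc n)
  define a b where "a = sqrt_iterate y (Suc n)" and "b = sqrt_iterate y n"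
  define \<alpha> \<beta> where "\<alpha> = sqrt_iterate (1::real) (Suc n)" and "\<beta> = sqrt_iterate (1::real) n"
  have ab: "a * b = b * a" unfolding a_def b_def
    by (intro sqrt_iterate_commute sqrt_iterate_commute[symmetric]) simp
  have le: "norm (a - b) \<le> \<alpha> - \<beta>" "norm (a + b) \<le> \<alpha> + \<beta>"
    using Suc norm_triangle_mono[OF norm_sqrt_iterate[OF assms] norm_sqrt_iterate[OF assms], of "Suc n" n]
    unfolding a_def b_def \<alpha>_def \<beta>_def by auto
  have "sqrt_iterate y (Suc (Suc n)) - sqrt_iterate y (Suc n)
      = (1/2) *\<^sub>R (y + a * a) - (1/2) *\<^sub>R (y + b * b)"
    unfolding a_def b_def by simp
  also have "\<dots> = (1/2) *\<^sub>R ((a - b) * (a + b))"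
    using ab by (simp add: algebra_simps)
  finally have "norm (sqrt_iterate y (Suc (Suc n)) - sqrt_iterate y (Suc n)) = norm ((a - b) * (a + b)) / 2"
    by simp
  also have "norm ((a - b) * (a + b)) \<le> (\<alpha> - \<beta>) * (\<alpha> + \<beta>)"
    using norm_mult_ineq[of "a - b" "a + b"] mult_mono'[OF le] by (meson norm_ge_zero order_trans)
  also have "(\<alpha> - \<beta>) * (\<alpha> + \<beta>) / 2 = (1/2) *\<^sub>R (1 + \<alpha> * \<alpha>) - (1/2) *\<^sub>R (1 + \<beta> * \<beta>)"
    by (simp add: field_simps)
  also have "\<dots> = sqrt_iterate 1 (Suc (Suc n)) - sqrt_iterate 1 (Suc n)"
    unfolding \<alpha>_def \<beta>_def by simp
  finally show ?case by simp
qed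

lemma convergent_sqrt_iterate:
  fixes y :: "'a::{real_normed_algebra,banach}"
  assumes "norm y \<le> 1"
  shows "convergent (sqrt_iterate y)"
proof -
  let ?\<rho> = "sqrt_iterate (1::real)"
  have step: "?\<rho> n \<le> ?\<rho> (Suc n)" for n
    using norm_sqrt_iterate_step[of "1::real" n] norm_ge_zero[of "?\<rho> (Suc n) - ?\<rho> n"]
    by (simp del: sqrt_iterate.simps)
  have "incseq ?\<rho>" using step by (rule incseq_SucI)
  then have "convergent ?\<rho>"
    using incseq_convergent[of ?\<rho> 1] sqrt_iterate_one unfolding convergent_def by metis
  then have "summable (\<lambda>n. ?\<rho> (Suc n) - ?\<rho> n)"
    using telescope_summable convergent_LIMSEQ_iff by blast
  then have "summable (\<lambda>n. sqrt_iterate y (Suc n) - sqrt_iterate y n)"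
    by (rule summable_comparison_test'[where N = 0])
       (use norm_sqrt_iterate_step[OF assms] in blast)
  then have "convergent (\<lambda>n. \<Sum>i<n. sqrt_iterate y (Suc i) - sqrt_iterate y i)"
    by (simp only: summable_iff_convergent)
  moreover have "(\<Sum>i<n. sqrt_iterate y (Suc i) - sqrt_iterate y i) = sqrt_iterate y n" for n
    by (simp only: sum_lessThan_telescope) simp
  ultimately show ?thesis by (simp only:)
qed

text \<open>The limit \<open>r\<close> of the iterates satisfies \<open>r = (y + r\<^sup>2) / 2\<close>, that is \<open>(1 - r)\<^sup>2 = 1 - y\<close>.\<close>

lemma cstar_sqrt_one_minus:
  fixes y :: "'a::cstar_algebra"
  assumes sa: "star y = y" and le: "norm y \<le> 1"
  obtains s where "star s = s" "s * s = 1 - y" "norm (1 - s) \<le> 1"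
    "\<And>x. x * y = y * x \<Longrightarrow> x * s = s * x"
proof -
  obtain r where lim: "sqrt_iterate y \<longlonglongrightarrow> r"
    using convergent_sqrt_iterate[OF le] by (auto simp: convergent_def)
  have "(\<lambda>n. sqrt_iterate y (Suc n)) \<longlonglongrightarrow> (1/2) *\<^sub>R (y + r * r)"
    unfolding sqrt_iterate.simps by (intro tendsto_intros lim)
  then have r: "r = (1/2) *\<^sub>R (y + r * r)"
    using LIMSEQ_unique LIMSEQ_Suc[OF lim] by blast
  have "2 *\<^sub>R r = 2 *\<^sub>R ((1/2) *\<^sub>R (y + r * r))" by (rule arg_cong[OF r])
  then have r2: "2 *\<^sub>R r = y + r * r" by (simp only: scaleR_scaleR) simp
  have "star (sqrt_iterate y n) = sqrt_iterate y n" for n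
    by (induction n) (simp_all add: star_scaleR star_add star_mult sa)
  then have "sqrt_iterate y \<longlonglongrightarrow> star r"
    using bounded_linear.tendsto[OF bounded_linear_star lim] by simp
  then have "star r = r" using lim LIMSEQ_unique by blast
  then have "star (1 - r) = 1 - r" by (simp add: star_diff)
  moreover have "(1 - r) * (1 - r) = 1 - y"
    using r2 by (simp add: left_diff_distrib right_diff_distrib scaleR_2 diff_diff_eq2 add.commute)
      (simp add: algebra_simps)
  moreover have "norm r \<le> 1"
    by (rule LIMSEQ_le_const2[OF tendsto_norm[OF lim]])
       (use order_trans[OF norm_sqrt_iterate[OF le] conjunct2[OF sqrt_iterate_one]] in blast)
  moreover have "x * (1 - r) = (1 - r) * x" if "x * y = y * x" for x
  proof -
    have "(\<lambda>n. x * sqrt_iterate y n) \<longlonglongrightarrow> r * x"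
      unfolding sqrt_iterate_commute[OF that] by (intro tendsto_intros lim)
    moreover have "(\<lambda>n. x * sqrt_iterate y n) \<longlonglongrightarrow> x * r" by (intro tendsto_intros lim)
    ultimately have "x * r = r * x" by (rule LIMSEQ_unique[rotated])
    then show ?thesis by (simp add: left_diff_distrib right_diff_distrib)
  qed
  moreover have "norm (1 - (1 - r)) = norm r" by simp
  ultimately show ?thesis using that[of "1 - r"] by metis
qed

lemma scaleC_minus_one: "scaleC (-1) x = - (x :: 'a::complex_normed_vector)"
  using scaleC_of_real[of "-1" x] by simp

lemma scaleC_diff_right: "scaleC c (x - y) = scaleC c x - scaleC c (y :: 'a::complex_normed_vector)"
  using scaleC_add_right[of c "x - y" y] by (simp add: algebra_simps)

text \<open>Both \<open>s\<close> and \<open>r\<close> are real or imaginary part of \<open>s + i r\<close>, whose square norm is that of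
  \<open>(s - i r) (s + i r) = s\<^sup>2 + r\<^sup>2\<close>.\<close>

lemma norm_le_sum_squares:
  fixes s r :: "'a::cstar_algebra"
  assumes "star s = s" "star r = r" "s * r = r * s"
  shows "norm s * norm s \<le> norm (s * s + r * r)"
proof -
  define u where "u = s + scaleC \<i> r"
  have ci: "scaleC (- \<i>) x = - scaleC \<i> x" for x :: 'a
    using scaleC_minus_one[of "scaleC \<i> x"] scaleC_scaleC[of "-1" \<i> x] by simp
  have u': "star u = s - scaleC \<i> r"
    unfolding u_def using assms by (simp add: star_add star_scaleC ci)
  have "star u * u = s * s + r * r"
    unfolding u' unfolding u_def using assms(3)
    by (simp add: algebra_simps mult_scaleC_left mult_scaleC_right scaleC_diff_right scaleC_scaleC
        scaleC_minus_one)
  then have nu: "norm (s * s + r * r) = norm u * norm u"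
    by (metis cstar_identity power2_eq_square)
  have "2 *\<^sub>R s = u + star u" unfolding u' by (simp add: u_def scaleR_2)
  then have "2 * norm s \<le> norm u + norm (star u)"
    by (metis norm_scaleR norm_triangle_ineq abs_numeral)
  then have "norm s \<le> norm u" by (simp add: norm_star)
  then show ?thesis unfolding nu by (simp add: mult_mono')
qed

text \<open>For self-adjoint \<open>a\<close> this says that the spectrum lies in \<open>[0, 2 t]\<close>.  The bound on a norm
  makes sums of positive elements positive and allows the square root above to be taken.\<close>

definition positive_element :: "'a::cstar_algebra \<Rightarrow> bool" where
  "positive_element a \<longleftrightarrow> star a = a \<and> (\<exists>t\<ge>0. norm (t *\<^sub>R 1 - a) \<le> t)"

lemma positive_element_add:
  assumes "positive_element a" "positive_element b"
  shows "positive_element (a + b)"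
proof -
  obtain t t' where t: "t \<ge> 0" "norm (t *\<^sub>R 1 - a) \<le> t" "t' \<ge> 0" "norm (t' *\<^sub>R 1 - b) \<le> t'"
    using assms unfolding positive_element_def by blast
  have "norm ((t + t') *\<^sub>R 1 - (a + b)) \<le> t + t'"
    using norm_triangle_mono[OF t(2,4)] by (simp add: algebra_simps)
  then show ?thesis using assms t(1,3) unfolding positive_element_def
    by (metis add_nonneg_nonneg star_add)
qed

lemma positive_element_sqrt:
  assumes "positive_element a"
  obtains s where "star s = s" "s * s = a" "positive_element s"
    "\<And>x. x * a = a * x \<Longrightarrow> x * s = s * x"
proof -
  obtain t where t: "t \<ge> 0" "norm (t *\<^sub>R 1 - a) \<le> t" and sa: "star a = a"
    using assms unfolding positive_element_def by blast
  show ?thesis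
  proof (cases "t = 0")
    case True
    then have "a = 0" using t by simp
    then show ?thesis using that[of 0] assms by simp
  next
    case False
    then have pos: "t > 0" using t by simp
    define y where "y = 1 - (1/t) *\<^sub>R a"
    have "y = (1/t) *\<^sub>R (t *\<^sub>R 1 - a)" unfolding y_def using pos by (simp add: algebra_simps)
    then have "norm y = (1/t) * norm (t *\<^sub>R 1 - a)" using pos by simp
    also have "\<dots> \<le> (1/t) * t" using t pos by (intro mult_left_mono) auto
    finally have "norm y \<le> 1" using pos by simp
    moreover have "star y = y" unfolding y_def by (simp add: star_diff star_scaleR sa)
    ultimately obtain s where s: "star s = s" "s * s = 1 - y" "norm (1 - s) \<le> 1"
      "\<And>x. x * y = y * x \<Longrightarrow> x * s = s * x"
      using cstar_sqrt_one_minus by blast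
    have "(sqrt t *\<^sub>R s) * (sqrt t *\<^sub>R s) = t *\<^sub>R (1 - y)"
      using s(2) pos by simp
    then have "(sqrt t *\<^sub>R s) * (sqrt t *\<^sub>R s) = a" using pos by (simp add: y_def)
    moreover have "norm (sqrt t *\<^sub>R 1 - sqrt t *\<^sub>R s) \<le> sqrt t"
      using s(3) pos by (simp add: mult_left_le flip: scaleR_diff_right)
    then have "positive_element (sqrt t *\<^sub>R s)"
      unfolding positive_element_def using s(1) pos by (metis star_scaleR real_sqrt_ge_zero t(1))
    moreover have "x * (sqrt t *\<^sub>R s) = (sqrt t *\<^sub>R s) * x" if "x * a = a * x" for x
      using s(4)[of x] that unfolding y_def by (simp add: algebra_simps)
    ultimately show ?thesis using that s(1) by (metis star_scaleR)
  qed
qed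

lemma positive_element_square:
  fixes a :: "'a::cstar_algebra"
  assumes sa: "star a = a"
  shows "positive_element (a * a)"
proof (cases "a = 0")
  case True
  then show ?thesis unfolding positive_element_def by (auto intro!: exI[of _ 0])
next
  case False
  define b where "b = (1 / norm a) *\<^sub>R a"
  have nb: "norm b = 1" unfolding b_def using False by simp
  have sb: "star b = b" unfolding b_def by (simp add: star_scaleR sa)
  have "star (b * b) = b * b" "norm (b * b) \<le> 1"
    using sb nb by (simp_all add: star_mult norm_self_adjoint_square)
  then obtain s where s: "star s = s" "s * s = 1 - b * b"
    "\<And>x. x * (b * b) = (b * b) * x \<Longrightarrow> x * s = s * x"
    using cstar_sqrt_one_minus by blast
  have "b * s = s * b" using s(3) by (simp add: mult.assoc)
  then have "norm s * norm s \<le> norm (s * s + b * b)"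
    using norm_le_sum_squares s(1) sb by metis
  also have "\<dots> \<le> 1" using s(2) norm_one_le_one by simp
  finally have "norm (1 - b * b) \<le> 1"
    using s(1,2) norm_self_adjoint_square by metis
  then have "norm ((norm a)\<^sup>2 *\<^sub>R (1 - b * b)) \<le> (norm a)\<^sup>2"
    by (simp add: mult_left_le)
  moreover have "(norm a)\<^sup>2 *\<^sub>R (1 - b * b) = (norm a)\<^sup>2 *\<^sub>R 1 - a * a"
    using False unfolding b_def by (simp add: algebra_simps power2_eq_square)
  ultimately show ?thesis unfolding positive_element_def
    using sa by (metis star_mult zero_le_power2)
qed

lemma positive_element_projection: "projection p \<Longrightarrow> positive_element p"
  using positive_element_square[of p] by (simp add: projection_def)

text \<open>If \<open>\<parallel>t + p\<parallel> \<le> t\<close>, multiplying by \<open>p\<close> gives \<open>(t + 1) \<parallel>p\<parallel> \<le> t \<parallel>p\<parallel>\<close>.\<close>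

lemma negative_projection_eq_zero:
  fixes p :: "'a::cstar_algebra"
  assumes "projection p" "positive_element (- p)"
  shows "p = 0"
proof -
  obtain t where t: "t \<ge> 0" "norm (t *\<^sub>R 1 + p) \<le> t"
    using assms(2) unfolding positive_element_def by auto
  have "(t + 1) *\<^sub>R p = p * (t *\<^sub>R 1 + p)"
    using assms(1) by (simp add: projection_def algebra_simps)
  then have "(t + 1) * norm p \<le> norm p * t"
    using norm_mult_ineq[of p "t *\<^sub>R 1 + p"] mult_left_mono[OF t(2), of "norm p"] t(1)
    by (metis abs_of_nonneg add_nonneg_nonneg norm_ge_zero norm_scaleR order_trans zero_le_one)
  then show ?thesis by (simp add: algebra_simps)
qed

text \<open>The relation \<open>u\<^sup>* u = - q\<close> makes \<open>p = - u u\<^sup>*\<close> a projection as well, and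
  \<open>2 (u u\<^sup>* + u\<^sup>* u)\<close> is the sum of the squares of \<open>u + u\<^sup>*\<close> and \<open>i (u - u\<^sup>*)\<close>, so that \<open>- q\<close> is a
  sum of positive elements.\<close>

lemma star_mult_self_eq_negative_projection:
  fixes u :: "'a::cstar_algebra"
  assumes q: "projection q" and u: "star u * u = - q"
  shows "q = 0"
proof -
  have "star (u * (1 - q)) * (u * (1 - q)) = (1 - q) * (star u * u) * (1 - q)"
    using q by (simp add: star_mult star_diff projection_star mult.assoc)
  also have "\<dots> = 0" using q unfolding u by (simp add: algebra_simps projection_idem)
  finally have "u * (1 - q) = 0" by (rule iffD1[OF star_mult_self_eq_zero])
  then have uq: "u * q = u" by (simp add: right_diff_distrib)
  define p where "p = - (u * star u)"
  have "p * p = u * (star u * u) * star u" unfolding p_def by (simp add: mult.assoc)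
  also have "\<dots> = p" unfolding u p_def using uq by (simp flip: mult.assoc)
  finally have p: "projection p"
    by (simp add: projection_def p_def star_uminus star_mult star_star)
  define a1 a2 where "a1 = u + star u" and "a2 = scaleC \<i> (u - star u)"
  have "star a1 = a1" unfolding a1_def by (simp add: star_add star_star add.commute)
  then have pos1: "positive_element (a1 * a1)" by (rule positive_element_square)
  have "star a2 = scaleC (- \<i>) (star u - u)"
    unfolding a2_def by (simp add: star_scaleC star_diff star_star)
  also have "\<dots> = scaleC (- \<i>) (scaleC (-1) (u - star u))" by (simp add: scaleC_minus_one)
  also have "\<dots> = a2" unfolding a2_def by (simp add: scaleC_scaleC)
  finally have pos2: "positive_element (a2 * a2)" by (rule positive_element_square)
  have "a2 * a2 = - ((u - star u) * (u - star u))"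
    unfolding a2_def by (simp add: mult_scaleC_left mult_scaleC_right scaleC_scaleC scaleC_minus_one)
  then have "a1 * a1 + a2 * a2 = (u * star u + u * star u) + (star u * u + star u * u)"
    unfolding a1_def by (simp add: algebra_simps)
  also have "\<dots> = - (p + p) - (q + q)" unfolding u p_def by simp
  finally have squares: "a1 * a1 + a2 * a2 = - (p + p) - (q + q)" .
  have "(a1 * a1 + a2 * a2) + (p + p) + q = - q" unfolding squares by simp
  moreover have "positive_element ((a1 * a1 + a2 * a2) + (p + p) + q)"
    by (intro positive_element_add pos1 pos2 positive_element_projection p q)
  ultimately show ?thesis using negative_projection_eq_zero[OF q] by simp
qed

lemma projection_absorb_right:
  fixes a e :: "'a::star_ring"
  assumes "projection e" "star a = a" "e * a = a"
  shows "a * e = a"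
proof -
  have "a * e = star (e * a)" using assms(1,2) by (simp add: star_mult projection_star)
  then show ?thesis using assms(2,3) by simp
qed

lemma commute_mult:
  fixes x :: "'a::semigroup_mult"
  assumes "x * a = a * x" "x * b = b * x"
  shows "x * (a * b) = (a * b) * x"
proof -
  have "x * (a * b) = a * (x * b)" unfolding mult.assoc[symmetric] assms(1) ..
  then show ?thesis unfolding assms(2) mult.assoc .
qed

lemma positive_element_star: "positive_element a \<Longrightarrow> star a = a"
  by (simp add: positive_element_def)

lemma cstar_absolute_value:
  fixes a :: "'a::cstar_algebra"
  assumes sa: "star a = a"
  obtains m where "positive_element m" "m * m = a * a" "norm m = norm a"
    "\<And>x. x * a = a * x \<Longrightarrow> x * m = m * x"
proof -
  obtain m where m: "star m = m" "m * m = a * a" "positive_element m"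
    and comm: "\<And>x. x * (a * a) = (a * a) * x \<Longrightarrow> x * m = m * x"
    using positive_element_sqrt[OF positive_element_square[OF sa]] by blast
  have "norm m * norm m = norm a * norm a"
    using norm_self_adjoint_square[OF m(1)] norm_self_adjoint_square[OF sa] m(2) by simp
  then have "norm m = norm a"
    by (metis norm_ge_zero power2_eq_iff_nonneg power2_eq_square)
  moreover have "x * m = m * x" if "x * a = a * x" for x
    by (rule comm[OF commute_mult[OF that that]])
  ultimately show ?thesis using that m(2,3) by blast
qed

text \<open>With \<open>w\<^sup>2 = 4 m (1 - m)\<close> the squares of \<open>2 m - 1\<close> and \<open>w\<close> add up to \<open>1\<close>.\<close>

lemma norm_positive_minus_half:
  fixes m :: "'a::cstar_algebra"
  assumes pos: "positive_element m" and le: "norm m \<le> 1"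
  shows "norm (m - (1/2) *\<^sub>R 1) \<le> 1/2"
proof -
  have sa: "star m = m" using pos by (rule positive_element_star)
  obtain s where s: "star s = s" "s * s = m" and s_comm: "\<And>x. x * m = m * x \<Longrightarrow> x * s = s * x"
    using positive_element_sqrt[OF pos] by blast
  obtain r where r: "star r = r" "r * r = 1 - m" and r_comm: "\<And>x. x * m = m * x \<Longrightarrow> x * r = r * x"
    using cstar_sqrt_one_minus[OF sa le] by blast
  have ms: "m * s = s * m" and mr: "m * r = r * m" by (rule s_comm r_comm, simp)+
  have sr: "s * r = r * s" by (rule r_comm[OF ms[symmetric]])
  define y w where "y = m + m - 1" and "w = 2 *\<^sub>R (s * r)"
  have y: "star y = y" unfolding y_def by (simp add: star_diff star_add sa)
  have w: "star w = w" unfolding w_def by (simp add: star_scaleR star_mult s(1) r(1) sr)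
  have "m * (s * r) = (s * r) * m" by (rule commute_mult[OF ms mr])
  then have yw: "y * w = w * y"
    unfolding y_def w_def
    by (simp add: left_diff_distrib right_diff_distrib distrib_left distrib_right
        scaleR_diff_right scaleR_add_right)
  have "(s * r) * (s * r) = s * (r * s) * r" by (simp only: mult.assoc)
  also have "\<dots> = (s * s) * (r * r)" unfolding sr[symmetric] by (simp only: mult.assoc)
  finally have "w * w = 4 *\<^sub>R (m - m * m)"
    unfolding w_def s(2) r(2) by (simp add: right_diff_distrib)
  then have "w * w = 2 *\<^sub>R (2 *\<^sub>R (m - m * m))" by simp
  then have "y * y + w * w = 1"
    unfolding y_def scaleR_2 by (simp add: algebra_simps)
  then have "norm y * norm y \<le> 1"
    using norm_le_sum_squares[OF y w yw] norm_one_le_one[where 'a = 'a] by (metis order_trans)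
  then have "norm y \<le> 1" by (simp add: abs_square_le_1 flip: power2_eq_square)
  moreover have "m - (1/2) *\<^sub>R 1 = (1/2) *\<^sub>R y"
    unfolding y_def by (simp add: scaleR_diff_right scaleR_add_right flip: scaleR_left.add)
  ultimately show ?thesis by simp
qed

text \<open>The inverse of \<open>1 - y\<close> is the fixed point of the contraction \<open>z \<mapsto> 1 + y z\<close>.\<close>

lemma one_minus_inverse:
  fixes y :: "'a::cstar_algebra"
  assumes "norm y < 1"
  obtains z where "(1 - y) * z = 1" "z * (1 - y) = 1"
proof -
  have "dist (1 + y * u) (1 + y * v) \<le> norm y * dist u v" for u v
    using norm_mult_ineq[of y "u - v"] by (simp add: dist_norm right_diff_distrib)
  then have "\<exists>!z. 1 + y * z = z" using assms by (intro banach_fix_type[of "norm y"]) auto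
  then obtain z where "1 + y * z = z" by blast
  then have "z - y * z = 1" by (simp only: diff_eq_eq)
  then have z: "(1 - y) * z = 1" by (simp add: left_diff_distrib)
  have "dist (1 + u * y) (1 + v * y) \<le> norm y * dist u v" for u v
    using norm_mult_ineq[of "u - v" y] by (simp add: dist_norm left_diff_distrib mult.commute)
  then have "\<exists>!z. 1 + z * y = z" using assms by (intro banach_fix_type[of "norm y"]) auto
  then obtain x where "1 + x * y = x" by blast
  then have "x - x * y = 1" by (simp only: diff_eq_eq)
  then have x: "x * (1 - y) = 1" by (simp add: right_diff_distrib)
  have "x = x * ((1 - y) * z)" unfolding z by simp
  also have "\<dots> = z" unfolding mult.assoc[symmetric] x by simp
  finally show ?thesis using that z x by simp
qed

lemma commute_inverse:
  fixes x :: "'a::monoid_mult"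
  assumes "a * z = 1" "z * a = 1" "x * a = a * x"
  shows "x * z = z * x"
proof -
  have "x * z = z * (a * x) * z" using assms(2) by (simp add: mult.assoc[symmetric])
  also have "\<dots> = z * x * (a * z)" unfolding assms(3)[symmetric] by (simp only: mult.assoc)
  finally show ?thesis by (simp add: assms(1))
qed

text \<open>A positive element plus \<open>\<epsilon>\<close> is a multiple of \<open>1 - y\<close> with \<open>\<parallel>y\<parallel> < 1\<close>, which has both a square root
  and an inverse.\<close>

lemma positive_plus_scalar_inverse_sqrt:
  fixes k :: "'a::cstar_algebra"
  assumes pos: "positive_element k" and \<epsilon>: "\<epsilon> > 0"
  obtains c where "star c = c" "c * c * (\<epsilon> *\<^sub>R 1 + k) = 1"
    "\<And>x. x * k = k * x \<Longrightarrow> x * c = c * x"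
proof -
  obtain t where t: "t \<ge> 0" "norm (t *\<^sub>R 1 - k) \<le> t" using pos unfolding positive_element_def by blast
  define T where "T = t + \<epsilon>"
  have T: "T > 0" "t < T" using t(1) \<epsilon> unfolding T_def by auto
  define y where "y = (1/T) *\<^sub>R (t *\<^sub>R 1 - k)"
  have "norm y = (1/T) * norm (t *\<^sub>R 1 - k)" using T unfolding y_def by simp
  also have "\<dots> \<le> (1/T) * t" using t(2) T by (intro mult_left_mono) auto
  also have "\<dots> < 1" using T by simp
  finally have y1: "norm y < 1" .
  have ysa: "star y = y"
    unfolding y_def using positive_element_star[OF pos] by (simp add: star_scaleR star_diff)
  obtain s where s: "star s = s" "s * s = 1 - y" and s_comm: "\<And>x. x * y = y * x \<Longrightarrow> x * s = s * x"
    using cstar_sqrt_one_minus[OF ysa less_imp_le[OF y1]] by blast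
  obtain z where z: "(1 - y) * z = 1" "z * (1 - y) = 1" using one_minus_inverse[OF y1] by blast
  have k: "\<epsilon> *\<^sub>R 1 + k = T *\<^sub>R (1 - y)"
    unfolding y_def T_def using T by (simp add: T_def scaleR_diff_right scaleR_left_distrib)
  have "star z * (1 - y) = 1" using arg_cong[OF z(1), of star] by (simp add: star_mult star_diff ysa)
  then have "star z * (1 - y) * z = z" by simp
  then have zsa: "star z = z" unfolding mult.assoc z(1) by simp
  have y_comm: "x * y = y * x" if "x * k = k * x" for x
    unfolding y_def using that by (simp add: left_diff_distrib right_diff_distrib)
  have z_comm: "x * z = z * x" if "x * y = y * x" for x
    by (rule commute_inverse[OF z]) (simp add: left_diff_distrib right_diff_distrib that)
  have sz: "s * z = z * s" by (rule z_comm[OF sym[OF s_comm[OF refl]]])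
  define c where "c = (1 / sqrt T) *\<^sub>R (z * s)"
  have "(z * s) * (z * s) = z * (s * z) * s" by (simp only: mult.assoc)
  also have "\<dots> = z * z * (s * s)" unfolding sz by (simp only: mult.assoc)
  also have "\<dots> = z" unfolding s(2) mult.assoc z(2) by simp
  finally have "c * c = (1/T) *\<^sub>R z" unfolding c_def using T by (simp add: real_sqrt_mult[symmetric])
  then have "c * c * (\<epsilon> *\<^sub>R 1 + k) = 1" unfolding k using T z(2) by simp
  moreover have "star c = c" unfolding c_def by (simp add: star_scaleR star_mult zsa s(1) sz)
  moreover have "x * c = c * x" if "x * k = k * x" for x
  proof -
    have "x * (z * s) = (z * s) * x"
      by (rule commute_mult[OF z_comm[OF y_comm[OF that]] s_comm[OF y_comm[OF that]]])
    then show ?thesis unfolding c_def by simp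
  qed
  ultimately show ?thesis using that by blast
qed

section \<open>The corner of an abelian projection is commutative\<close>

lemma abelian_projection_projection: "abelian_projection e \<Longrightarrow> projection e"
  by (simp add: abelian_projection_def)

lemma abelian_corner_idempotent_commute:
  assumes e: "abelian_projection e" and h: "e * h = h" "h * e = h" "h * h = h"
    and x: "e * x = x" "x * e = x"
  shows "h * x = x * h"
proof -
  have "h \<in> corner e" unfolding corner_def by (rule range_eqI[of _ _ h]) (simp add: h)
  moreover have "x \<in> corner e" unfolding corner_def by (rule range_eqI[of _ _ x]) (simp add: x)
  ultimately show ?thesis using e h(3) unfolding abelian_projection_def abelian_ring_on_def by blast
qed

text \<open>This is the polar decomposition \<open>a = m (2 h - e)\<close> of \<open>a\<close>, with \<open>m\<close> its absolute value.  Here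
  \<open>h\<close> is the support of \<open>m + a\<close>, and it annihilates \<open>m - a\<close> since \<open>(m + a) (m - a) = 0\<close>.\<close>

lemma corner_self_adjoint_polar:
  fixes e a :: "'a::cstar_algebra"
  assumes baer: "baer_star_ring TYPE('a)" and e: "projection e" and sa: "star a = a" and ea: "e * a = a"
  obtains m h where "positive_element m" "norm m = norm a" "e * m = m" "m * e = m"
    "projection h" "e * h = h" "h * e = h" "m = a * (h + h - e)"
proof -
  have ae: "a * e = a" by (rule projection_absorb_right[OF e sa ea])
  obtain m where pos: "positive_element m" and mm: "m * m = a * a" and nm: "norm m = norm a"
    and comm: "\<And>x. x * a = a * x \<Longrightarrow> x * m = m * x"
    using cstar_absolute_value[OF sa] by blast
  have msa: "star m = m" using pos by (rule positive_element_star)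
  have am: "a * m = m * a" by (rule comm) simp
  have "star (m * (1 - e)) * (m * (1 - e)) = (1 - e) * (m * m) * (1 - e)"
    by (simp add: star_mult star_diff msa projection_star[OF e] mult.assoc)
  also have "\<dots> = 0" unfolding mm by (simp add: right_diff_distrib mult.assoc ae)
  finally have "m * (1 - e) = 0" by (rule iffD1[OF star_mult_self_eq_zero])
  then have me: "m * e = m" by (simp add: right_diff_distrib)
  have "star (m * e) = star m" unfolding me ..
  then have em: "e * m = m" unfolding star_mult msa projection_star[OF e] .
  obtain h :: 'a where h: "projection h" and sup: "\<And>y. h * y = 0 \<longleftrightarrow> (\<forall>s\<in>{m + a}. s * y = 0)"
    using baer_support[OF baer, of "{m + a}"] by blast
  have "(m + a) * (m - a) = 0" using mm am by (simp add: distrib_right right_diff_distrib)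
  then have "h * (m - a) = 0" using sup by simp
  then have "star (h * (m - a)) = 0" by simp
  then have *: "m * h = a * h" by (simp add: star_mult star_diff msa sa projection_star[OF h] left_diff_distrib)
  have "(m + a) * h = m + a" by (rule support_absorb[OF h sup]) simp
  then have "m = a * h + a * h - a" by (simp add: distrib_right * eq_diff_eq)
  then have m: "m = a * (h + h - e)" by (simp add: right_diff_distrib distrib_left ae)
  have "(m + a) * (1 - e) = 0" by (simp add: right_diff_distrib distrib_right me ae)
  then have "h * (1 - e) = 0" using sup by simp
  then have he: "h * e = h" by (simp add: right_diff_distrib)
  have "star (h * e) = star h" unfolding he ..
  then have "e * h = h" unfolding star_mult projection_star[OF e] projection_star[OF h] .
  show ?thesis by (rule that[OF pos nm em me h \<open>e * h = h\<close> he m])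
qed

lemma symmetry_square:
  fixes e h :: "'a::star_ring"
  assumes "projection e" "projection h" "e * h = h" "h * e = h"
  shows "(h + h - e) * (h + h - e) = e"
  using assms by (simp add: projection_idem distrib_left distrib_right left_diff_distrib right_diff_distrib)

text \<open>A self-adjoint contraction \<open>a = m w\<close> with \<open>0 \<le> m \<le> 1\<close> and a central symmetry \<open>w\<close> lies within
  \<open>1/2\<close> of the central element \<open>w / 2\<close>.  Rescaling the remainder and repeating, \<open>a\<close> is a norm limit
  of central elements.\<close>

lemma abelian_corner_central_approximation:
  fixes e a :: "'a::cstar_algebra"
  assumes baer: "baer_star_ring TYPE('a)" and e: "abelian_projection e"
    and sa: "star a = a" and ea: "e * a = a" and le: "norm a \<le> 1"
  shows "\<exists>c. star c = c \<and> e * c = c \<and> norm (a - c) \<le> (1/2) ^ n \<and>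
    (\<forall>x. e * x = x \<longrightarrow> x * e = x \<longrightarrow> c * x = x * c)"
proof (induction n)
  case 0
  show ?case using le by (intro exI[of _ 0]) simp
next
  case (Suc n)
  then obtain c where c: "star c = c" "e * c = c" "norm (a - c) \<le> (1/2) ^ n"
    and central: "\<And>x. e * x = x \<Longrightarrow> x * e = x \<Longrightarrow> c * x = x * c" by blast
  have pe: "projection e" using e by (rule abelian_projection_projection)
  define b where "b = 2 ^ n *\<^sub>R (a - c)"
  have "norm b \<le> 2 ^ n * (1/2) ^ n" unfolding b_def using c(3) by simp
  then have nb: "norm b \<le> 1" by (simp add: power_one_over)
  have bsa: "star b = b" "e * b = b"
    unfolding b_def by (simp_all add: star_scaleR star_diff sa c right_diff_distrib ea)
  obtain m h where m: "positive_element m" "norm m = norm b" "e * m = m" "m * e = m"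
    and h: "projection h" "e * h = h" "h * e = h" and mb: "m = b * (h + h - e)"
    by (rule corner_self_adjoint_polar[OF baer pe bsa])
  define w where "w = h + h - e"
  have ww: "w * w = e" unfolding w_def by (rule symmetry_square[OF pe h])
  have wsa: "star w = w"
    unfolding w_def by (simp add: star_diff star_add projection_star[OF h(1)] projection_star[OF pe])
  have ew: "e * w = w" unfolding w_def by (simp add: right_diff_distrib distrib_left h projection_idem[OF pe])
  have "b * e = b" by (rule projection_absorb_right[OF pe bsa])
  then have mw: "m * w = b" unfolding mb w_def[symmetric] mult.assoc ww .
  have "norm w * norm w \<le> 1"
    using norm_self_adjoint_square[OF wsa] norm_projection_le_one[OF pe] ww by simp
  then have nw: "norm w \<le> 1" by (simp add: abs_square_le_1 flip: power2_eq_square)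
  have "b - (1/2) *\<^sub>R w = (m - (1/2) *\<^sub>R 1) * w" by (simp add: left_diff_distrib mw)
  then have "norm (b - (1/2) *\<^sub>R w) \<le> norm (m - (1/2) *\<^sub>R 1) * norm w" by (simp add: norm_mult_ineq)
  also have "\<dots> \<le> 1/2 * 1"
    using norm_positive_minus_half[OF m(1)] m(2) nb nw by (intro mult_mono) auto
  finally have dist: "norm (b - (1/2) *\<^sub>R w) \<le> 1/2" by simp
  have w_comm: "w * x = x * w" if "e * x = x" "x * e = x" for x
    using abelian_corner_idempotent_commute[OF e h(2,3) projection_idem[OF h(1)] that] that
    unfolding w_def by (simp add: left_diff_distrib right_diff_distrib distrib_left distrib_right)
  define c' where "c' = c + (1/2) ^ Suc n *\<^sub>R w"
  have "a - c' = (1/2) ^ n *\<^sub>R (b - (1/2) *\<^sub>R w)"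
    unfolding b_def c'_def by (simp add: scaleR_diff_right power_one_over)
  then have "norm (a - c') \<le> (1/2) ^ n * (1/2)" using dist by (simp add: mult_left_mono del: times_divide_eq_right)
  then have "norm (a - c') \<le> (1/2) ^ Suc n" by simp
  moreover have "star c' = c'" "e * c' = c'"
    unfolding c'_def by (simp_all add: star_add star_scaleR c wsa distrib_left ew)
  moreover have "c' * x = x * c'" if "e * x = x" "x * e = x" for x
    unfolding c'_def using central[OF that] w_comm[OF that] by (simp add: distrib_left distrib_right)
  ultimately show ?case by blast
qed

lemma abelian_corner_self_adjoint_commute:
  fixes e a x :: "'a::cstar_algebra"
  assumes baer: "baer_star_ring TYPE('a)" and e: "abelian_projection e"
    and sa: "star a = a" and ea: "e * a = a" and x: "e * x = x" "x * e = x"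
  shows "a * x = x * a"
proof -
  define b where "b = (1 / (norm a + 1)) *\<^sub>R a"
  have na: "norm a + 1 > 0" by (simp add: add_nonneg_pos)
  have b: "star b = b" "e * b = b" unfolding b_def by (simp_all add: star_scaleR sa ea)
  have nb: "norm b \<le> 1" unfolding b_def using na by simp
  have bound: "norm (b * x - x * b) \<le> (2 * norm x) * (1/2) ^ n" for n
  proof -
    obtain c where c: "norm (b - c) \<le> (1/2) ^ n" "c * x = x * c"
      using abelian_corner_central_approximation[OF baer e b nb] x by blast
    have "b * x - x * b = (b - c) * x - x * (b - c)" by (simp add: left_diff_distrib right_diff_distrib c(2))
    then have "norm (b * x - x * b) \<le> norm ((b - c) * x) + norm (x * (b - c))" by (simp add: norm_triangle_ineq4)
    also have "\<dots> \<le> norm (b - c) * norm x + norm x * norm (b - c)" by (intro add_mono norm_mult_ineq)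
    also have "\<dots> = (2 * norm x) * norm (b - c)" by simp
    also have "\<dots> \<le> (2 * norm x) * (1/2) ^ n" by (intro mult_left_mono c(1)) simp
    finally show ?thesis .
  qed
  have "(\<lambda>n. (2 * norm x) * (1/2) ^ n) \<longlonglongrightarrow> (2 * norm x) * 0"
    by (intro tendsto_mult tendsto_const LIMSEQ_power_zero) simp
  then have "norm (b * x - x * b) \<le> (2 * norm x) * 0"
    by (rule LIMSEQ_le_const) (use bound in blast)
  then have "b * x = x * b" by simp
  then have "(1 / (norm a + 1)) *\<^sub>R (a * x) = (1 / (norm a + 1)) *\<^sub>R (x * a)" unfolding b_def by simp
  then show ?thesis using na by simp
qed

lemma abelian_corner_commute:
  fixes e x y :: "'a::cstar_algebra"
  assumes baer: "baer_star_ring TYPE('a)" and e: "abelian_projection e"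
    and y: "e * y = y" "y * e = y" and x: "e * x = x" "x * e = x"
  shows "y * x = x * y"
proof -
  have pe: "star e = e" by (rule projection_star[OF abelian_projection_projection[OF e]])
  define a1 a2 where "a1 = y + star y" and "a2 = scaleC \<i> (y - star y)"
  have ys: "e * star y = star y" using arg_cong[OF y(2), of star] by (simp add: star_mult pe)
  have "star a1 = a1" unfolding a1_def by (simp add: star_add star_star add.commute)
  moreover have "e * a1 = a1" unfolding a1_def by (simp add: distrib_left y ys)
  ultimately have 1: "a1 * x = x * a1" by (rule abelian_corner_self_adjoint_commute[OF baer e _ _ x])
  have "star a2 = scaleC (- \<i>) (scaleC (-1) (y - star y))"
    unfolding a2_def by (simp add: star_scaleC star_diff star_star scaleC_minus_one)
  then have "star a2 = a2" unfolding a2_def by (simp add: scaleC_scaleC)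
  moreover have "e * a2 = a2" unfolding a2_def by (simp add: mult_scaleC_right right_diff_distrib y ys)
  ultimately have 2: "a2 * x = x * a2" by (rule abelian_corner_self_adjoint_commute[OF baer e _ _ x])
  have "a1 - scaleC \<i> a2 = 2 *\<^sub>R y"
    unfolding a1_def a2_def by (simp add: scaleC_scaleC scaleC_minus_one scaleR_2)
  moreover have "(a1 - scaleC \<i> a2) * x = x * (a1 - scaleC \<i> a2)"
    by (simp add: left_diff_distrib right_diff_distrib mult_scaleC_left mult_scaleC_right 1 2)
  ultimately show ?thesis by simp
qed

text \<open>Put \<open>a = x\<^sup>* x\<close> with polar decomposition \<open>a = m (2 h - e)\<close>, and let \<open>k\<close> be the support of the
  positive part of \<open>m - \<parallel>a\<parallel> / 2\<close>.  It is nonzero, and \<open>m\<close> is bounded below on it, so that some \<open>t\<close> in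
  the corner satisfies \<open>t m t = k\<close> and hence \<open>(x t)\<^sup>* (x t) = k (2 h - e)\<close>.  If \<open>k h\<close> were zero, this
  would be \<open>- k\<close>, which is impossible; so multiplying \<open>x t\<close> by \<open>k h\<close> leaves the nonzero projection
  \<open>k h\<close>.\<close>

lemma abelian_local_partial_isometry:
  fixes e x :: "'a::cstar_algebra"
  assumes baer: "baer_star_ring TYPE('a)" and e: "abelian_projection e"
    and xe: "x * e = x" and "x \<noteq> 0"
  obtains t q where "projection q" "q \<noteq> 0" "e * q = q" "star (x * t) * (x * t) = q" "t * e = t"
proof -
  have pe: "projection e" using e by (rule abelian_projection_projection)
  have ee: "e * e = e" using pe by (rule projection_idem)
  note comm = abelian_corner_commute[OF baer e]
  define a where "a = star x * x"
  have asa: "star a = a" unfolding a_def by (simp add: star_mult star_star)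
  have "a * e = a" unfolding a_def mult.assoc xe ..
  then have "star (a * e) = star a" by simp
  then have ea: "e * a = a" unfolding star_mult asa projection_star[OF pe] .
  define \<epsilon> where "\<epsilon> = norm a / 2"
  have "a \<noteq> 0" using \<open>x \<noteq> 0\<close> unfolding a_def by (simp add: star_mult_self_eq_zero)
  then have \<epsilon>: "\<epsilon> > 0" unfolding \<epsilon>_def by simp
  obtain m h where m: "positive_element m" "norm m = norm a" "e * m = m" "m * e = m"
    and h: "projection h" "e * h = h" "h * e = h" and m_eq: "m = a * (h + h - e)"
    by (rule corner_self_adjoint_polar[OF baer pe asa ea])
  define w where "w = h + h - e"
  have ww: "w * w = e" unfolding w_def by (rule symmetry_square[OF pe h])
  have w: "e * w = w" "w * e = w"
    unfolding w_def by (simp_all add: right_diff_distrib left_diff_distrib distrib_left distrib_right h ee)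
  have a_eq: "a = m * w"
    unfolding m_eq w_def[symmetric] mult.assoc ww using projection_absorb_right[OF pe asa ea] by simp
  define b where "b = m - \<epsilon> *\<^sub>R e"
  have bsa: "star b = b"
    unfolding b_def using positive_element_star[OF m(1)]
    by (simp add: star_diff star_scaleR projection_star[OF pe])
  have eb: "e * b = b" unfolding b_def by (simp add: right_diff_distrib m ee)
  obtain m' k where m': "positive_element m'" and nm': "norm m' = norm b"
    and em': "e * m' = m'" "m' * e = m'"
    and k: "projection k" "e * k = k" "k * e = k" and m'_eq: "m' = b * (k + k - e)"
    by (rule corner_self_adjoint_polar[OF baer pe bsa eb])
  have kk: "k * k = k" using k(1) by (rule projection_idem)
  have be: "b * e = b" by (rule projection_absorb_right[OF pe bsa eb])
  obtain s where s: "star s = s" "s * s = m" and s_comm: "\<And>x. x * m = m * x \<Longrightarrow> x * s = s * x"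
    using positive_element_sqrt[OF m(1)] by blast
  obtain r where r: "star r = r" "r * r = m'" and r_comm: "\<And>x. x * m' = m' * x \<Longrightarrow> x * r = r * x"
    using positive_element_sqrt[OF m'] by blast
  have mm': "m * m' = m' * m" by (rule comm[OF m(3,4) em'])
  \<comment> \<open>Otherwise \<open>m \<le> \<epsilon>\<close>, contrary to \<open>\<parallel>m\<parallel> = 2 \<epsilon>\<close>.\<close>
  have k_nonzero: "k \<noteq> 0"
  proof
    assume "k = 0"
    then have "m' = \<epsilon> *\<^sub>R e - m" unfolding m'_eq using be by (simp add: b_def)
    then have sum: "s * s + r * r = \<epsilon> *\<^sub>R e" unfolding s(2) r(2) by simp
    have "r * s = s * r" by (rule s_comm[OF sym[OF r_comm[OF mm']]])
    then have "norm s * norm s \<le> norm (\<epsilon> *\<^sub>R e)"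
      using norm_le_sum_squares[OF s(1) r(1)] sum by simp
    also have "\<dots> \<le> \<epsilon> * 1" using norm_projection_le_one[OF pe] \<epsilon> by simp
    finally have "norm a \<le> \<epsilon>" using norm_self_adjoint_square[OF s(1)] s(2) m(2) by simp
    then show False using \<epsilon> unfolding \<epsilon>_def by simp
  qed
  define p where "p = m' * k"
  have m'k: "k * m' = m' * k" by (rule comm[OF k(2,3) em'])
  have rk: "k * r = r * k" by (rule r_comm[OF m'k])
  have rkk: "r * k * k = r * k" by (simp only: mult.assoc kk)
  have "(r * k) * (r * k) = r * (k * r) * k" by (simp only: mult.assoc)
  also have "\<dots> = p" unfolding rk p_def r(2)[symmetric] by (simp only: mult.assoc kk)
  finally have p_square: "(r * k) * (r * k) = p" .
  have "star (r * k) = r * k" by (simp add: star_mult r(1) projection_star[OF k(1)] rk)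
  then have "positive_element ((r * k) * (r * k))" by (rule positive_element_square)
  then have p_pos: "positive_element p" unfolding p_square .
  have kp: "k * p = p" unfolding p_def mult.assoc[symmetric] m'k by (simp only: mult.assoc kk)
  have pk: "p * k = p" unfolding p_def by (simp only: mult.assoc kk)
  have "m' * k = b * k"
    unfolding m'_eq mult.assoc by (simp add: left_diff_distrib distrib_right kk k(2))
  then have "m * k = p + \<epsilon> *\<^sub>R k"
    unfolding p_def b_def by (simp add: left_diff_distrib k(2))
  then have mk: "m * k = (\<epsilon> *\<^sub>R 1 + p) * k" by (simp add: distrib_right pk add.commute)
  obtain c where c: "star c = c" "c * c * (\<epsilon> *\<^sub>R 1 + p) = 1" and c_comm: "\<And>x. x * p = p * x \<Longrightarrow> x * c = c * x"
    using positive_plus_scalar_inverse_sqrt[OF p_pos \<epsilon>] by blast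
  have kc: "k * c = c * k" by (rule c_comm) (simp add: kp pk)
  define t where "t = c * k"
  have tsa: "star t = t" unfolding t_def by (simp add: star_mult c(1) projection_star[OF k(1)] kc)
  have te: "t * e = t" unfolding t_def by (simp only: mult.assoc k(3))
  have et: "e * t = t" unfolding t_def kc[symmetric] by (simp only: mult.assoc[symmetric] k(2))
  have tm: "t * m = m * t" by (rule comm[OF et te m(3,4)])
  have tw: "t * w = w * t" by (rule comm[OF et te w])
  have "t * t = c * (k * c) * k" unfolding t_def by (simp only: mult.assoc)
  then have "t * t = c * c * k" unfolding kc by (simp only: mult.assoc kk)
  then have "t * t * m = c * c * (m * k)"
    using comm[OF k(2,3) m(3,4)] by (simp only: mult.assoc)
  also have "\<dots> = k" unfolding mk mult.assoc[symmetric] c(2) by simp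
  finally have ttm: "t * t * m = k" .
  have "t * a * t = t * (m * w) * t" unfolding a_eq ..
  also have "\<dots> = t * m * (w * t)" by (simp only: mult.assoc)
  also have "\<dots> = t * (m * t) * w" unfolding tw[symmetric] by (simp only: mult.assoc)
  also have "\<dots> = k * w" unfolding tm[symmetric] mult.assoc[symmetric] ttm ..
  finally have tat: "t * a * t = k * w" .
  have kh: "k * h = h * k" by (rule comm[OF k(2,3) h(2,3)])
  have kh_nonzero: "k * h \<noteq> 0"
  proof
    assume "k * h = 0"
    then have "t * a * t = - k" unfolding tat w_def by (simp add: right_diff_distrib distrib_left k(3))
    then have "star (x * t) * (x * t) = - k"
      unfolding a_def star_mult tsa by (simp only: mult.assoc)
    then show False using star_mult_self_eq_negative_projection[OF k(1)] k_nonzero by blast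
  qed
  define q where "q = k * h"
  have hh: "h * h = h" using h(1) by (rule projection_idem)
  have qq: "q * q = q"
  proof -
    have "q * q = k * (h * k) * h" unfolding q_def by (simp only: mult.assoc)
    also have "\<dots> = (k * k) * (h * h)" unfolding kh[symmetric] by (simp only: mult.assoc)
    finally show ?thesis unfolding kk hh q_def .
  qed
  have q: "projection q"
    unfolding projection_def using qq
    by (simp add: q_def star_mult projection_star[OF k(1)] projection_star[OF h(1)] kh)
  have eq: "e * q = q" unfolding q_def mult.assoc[symmetric] k(2) ..
  have qe: "q * e = q" unfolding q_def mult.assoc h(3) ..
  have kq: "k * q = q" unfolding q_def mult.assoc[symmetric] kk ..
  have "h * q = q" unfolding q_def kh mult.assoc[symmetric] hh ..
  then have wq: "w * q = q" unfolding w_def by (simp add: left_diff_distrib distrib_right eq)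
  have "star (x * (t * q)) * (x * (t * q)) = q * (t * a * t) * q"
    unfolding a_def star_mult tsa projection_star[OF q] by (simp only: mult.assoc)
  also have "\<dots> = q" unfolding tat by (simp only: mult.assoc wq kq qq)
  finally have "star (x * (t * q)) * (x * (t * q)) = q" .
  moreover have "t * q * e = t * q" by (simp only: mult.assoc qe)
  moreover have "q \<noteq> 0" using kh_nonzero unfolding q_def .
  ultimately show ?thesis using that[OF q _ eq] by blast
qed

text \<open>For \<open>q \<le> e\<close> the corner gives \<open>q A (e - q) = 0\<close>, so the central cover of \<open>q\<close> annihilates
  \<open>e - q\<close>.\<close>

lemma abelian_subprojection_central:
  fixes e q :: "'a::star_ring"
  assumes baer: "baer_star_ring TYPE('a)" and e: "abelian_projection e"
    and q: "projection q" and eq: "e * q = q"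
  obtains c where "central_projection c" "q = c * e"
proof -
  have pe: "projection e" using e by (rule abelian_projection_projection)
  have qe: "q * e = q" by (rule projection_below_sym[OF pe q eq])
  obtain c :: 'a where c: "central_projection c" "\<And>y. c * y = 0 \<longleftrightarrow> (\<forall>a. q * a * y = 0)" "c * q = q"
    using baer_central_cover[OF baer, of q] by blast
  have "q * a * (e - q) = 0" for a
  proof -
    have ex: "e * (e * a * e) = e * a * e" "(e * a * e) * e = e * a * e"
      using projection_idem[OF pe] by (simp_all add: projection_idem_left[OF pe] mult.assoc)
    have qx: "q * (e * a * e) = (e * a * e) * q"
      by (rule abelian_corner_idempotent_commute[OF e eq qe projection_idem[OF q] ex])
    have "q * a * (e - q) = (q * e) * a * (e * (e - q))"
      unfolding qe by (simp add: right_diff_distrib projection_idem[OF pe] eq)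
    also have "\<dots> = (e * a * e) * (q * (e - q))"
      unfolding mult.assoc[symmetric] qx[unfolded mult.assoc[symmetric]] ..
    also have "\<dots> = 0" by (simp add: right_diff_distrib qe projection_idem[OF q])
    finally show ?thesis .
  qed
  then have "c * (e - q) = 0" using c(2) by blast
  then have "q = c * e" using c(3) by (simp add: right_diff_distrib)
  then show ?thesis using that c(1) by blast
qed

lemma faithful_central_mult_eq_zero:
  assumes "faithful_projection e" "central_projection c" "c * e = 0"
  shows "c = 0"
  using assms unfolding faithful_projection_def central_idempotent_def central_projection_def projection_def
  by blast

text \<open>The hypothesis says that the central cover of \<open>x\<close> annihilates \<open>e\<close>.\<close>

lemma faithful_mult_eq_zero:
  fixes x :: "'a::star_ring"
  assumes baer: "baer_star_ring TYPE('a)" and e: "faithful_projection e"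
    and zero: "\<And>a. x * a * e = 0"
  shows "x = 0"
proof -
  obtain c :: 'a where c: "central_projection c" "\<And>y. c * y = 0 \<longleftrightarrow> (\<forall>a. x * a * y = 0)" "c * x = x"
    using baer_central_cover[OF baer, of x] by blast
  have "c * e = 0" using c(2) zero by blast
  then have "c = 0" by (rule faithful_central_mult_eq_zero[OF e c(1)])
  then show ?thesis using c(3) by simp
qed

text \<open>In this form the initial projection is the part of \<open>e\<close> over a nonzero central projection.\<close>

lemma abelian_local_copy:
  fixes e x y :: "'a::cstar_algebra"
  assumes baer: "baer_star_ring TYPE('a)" and e: "abelian_projection e"
    and xe: "x * e = x" and x: "x \<noteq> 0" and y: "central_projection y" "y * x = x"
  obtains t y' where "central_projection y'" "y' \<noteq> 0" "y * y' = y'" "t * e = t"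
    "star (x * t) * (x * t) = y' * e"
proof -
  obtain t q where q: "projection q" "q \<noteq> 0" "e * q = q" and t: "star (x * t) * (x * t) = q" "t * e = t"
    by (rule abelian_local_partial_isometry[OF baer e xe x])
  obtain c where c: "central_projection c" "q = c * e"
    using abelian_subprojection_central[OF baer e q(1,3)] by blast
  have "y * q = star (x * t) * (y * x * t)"
    unfolding t(1)[symmetric] using central_projection_commute[OF y(1), of "star (x * t)"]
    by (simp only: mult.assoc[symmetric])
  then have yq: "y * q = q" unfolding y(2) t(1) .
  have "central_projection (y * c)" by (rule central_projection_mult[OF y(1) c(1)])
  moreover have "y * c * e = q" unfolding mult.assoc c(2)[symmetric] by (rule yq)
  moreover have "y * (y * c) = y * c"
    by (rule projection_idem_left[OF central_projection_projection[OF y(1)]])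
  moreover have "y * c \<noteq> 0" using \<open>y * c * e = q\<close> q(2) by auto
  moreover have "star (x * t) * (x * t) = y * c * e" using \<open>y * c * e = q\<close> t(1) by simp
  ultimately show ?thesis using that t(2) by blast
qed

section \<open>Gluing partial isometries and frames of matrix units\<close>

lemma partial_isometry_initial:
  fixes u p :: "'a::cstar_algebra"
  assumes "projection p" "star u * u * p = star u * u"
  shows "u * p = u"
proof -
  have "star (u * (1 - p)) * (u * (1 - p)) = (1 - p) * (star u * u * (1 - p))"
    by (simp only: star_mult star_diff star_one projection_star[OF assms(1)] mult.assoc)
  also have "star u * u * (1 - p) = 0" by (simp only: right_diff_distrib assms(2)) simp
  finally have "u * (1 - p) = 0" by (simp add: star_mult_self_eq_zero)
  then show ?thesis by (simp add: right_diff_distrib)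
qed

text \<open>The initial supports \<open>e i\<close> and the final supports of the \<open>u i\<close> are pairwise orthogonal, and
  every \<open>e i\<close> is orthogonal to every final support.  Let \<open>P\<close> be the supremum of the projections onto
  the graphs, that is onto the ranges of \<open>e i + u i\<close>.  It fixes \<open>e i + u i\<close> and annihilates
  \<open>e i - u i\<close>, so that \<open>2 F P E\<close> acts as \<open>u i\<close> on \<open>e i\<close>.\<close>

lemma glue_partial_isometries:
  fixes u :: "'b \<Rightarrow> 'a::cstar_algebra"
  assumes baer: "baer_star_ring TYPE('a)"
    and proj: "\<And>i. i \<in> I \<Longrightarrow> projection (star (u i) * u i)"
    and initial: "\<And>i j. i \<in> I \<Longrightarrow> j \<in> I \<Longrightarrow> i \<noteq> j \<Longrightarrow> u i * star (u j) = 0"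
    and final: "\<And>i j. i \<in> I \<Longrightarrow> j \<in> I \<Longrightarrow> i \<noteq> j \<Longrightarrow> star (u i) * u j = 0"
    and cross: "\<And>i j. i \<in> I \<Longrightarrow> j \<in> I \<Longrightarrow> u i * u j = 0"
    and E: "projection E" "\<And>y. E * y = 0 \<longleftrightarrow> (\<forall>i\<in>I. u i * y = 0)"
    and F: "projection F" "\<And>y. F * y = 0 \<longleftrightarrow> (\<forall>i\<in>I. star (u i) * y = 0)"
  obtains v where "star v * v = E" "v * star v = F"
proof -
  have EE: "E * E = E" and FF: "F * F = F" using E(1) F(1) by (auto intro: projection_idem)
  note st = projection_star[OF E(1)] projection_star[OF F(1)]
  define e where "e i = star (u i) * u i" for i
  define g where "g i = e i + u i" for i
  have e_star: "star (e i) = e i" for i unfolding e_def by (simp add: star_mult star_star)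
  have ue: "u i * e i = u i" if "i \<in> I" for i
    unfolding e_def by (rule partial_isometry_initial[OF proj[OF that] projection_idem[OF proj[OF that]]])
  have ee: "e i * e i = e i" if "i \<in> I" for i
    unfolding e_def by (rule projection_idem[OF proj[OF that]])
  have "E * (1 - E) = 0" by (simp add: right_diff_distrib EE)
  then have "\<forall>i\<in>I. u i * (1 - E) = 0" by (simp only: E(2))
  then have uE: "u i * E = u i" if "i \<in> I" for i using that by (simp add: right_diff_distrib)
  have "F * (1 - F) = 0" by (simp add: right_diff_distrib FF)
  then have "\<forall>i\<in>I. star (u i) * (1 - F) = 0" by (simp only: F(2))
  then have uF: "star (u i) * F = star (u i)" if "i \<in> I" for i using that by (simp add: right_diff_distrib)
  have Fu: "F * u i = u i" if "i \<in> I" for i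
    using arg_cong[OF uF[OF that], of star] by (simp only: star_mult star_star st)
  have eE: "e i * E = e i" if "i \<in> I" for i unfolding e_def mult.assoc uE[OF that] ..
  have Ee: "E * e i = e i" if "i \<in> I" for i
    using arg_cong[OF eE[OF that], of star] by (simp only: star_mult e_star st)
  have uu_star: "star (u j) * star (u i) = 0" if "i \<in> I" "j \<in> I" for i j
    using arg_cong[OF cross[OF that], of star] by (simp only: star_mult star_zero)
  have Eu: "E * u i = 0" if "i \<in> I" for i using E(2) cross that by blast
  have "star (u j) * e i = 0" if "i \<in> I" "j \<in> I" for i j
    unfolding e_def mult.assoc[symmetric] uu_star[OF that] by simp
  then have Fe: "F * e i = 0" if "i \<in> I" for i using F(2) that by blast
  obtain P :: 'a where P: "projection P" "\<And>y. P * y = 0 \<longleftrightarrow> (\<forall>s\<in>(\<lambda>i. star (g i)) ` I. s * y = 0)"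
    using baer_support[OF baer, of "(\<lambda>i. star (g i)) ` I"] by blast
  have Pg: "P * g i = g i" if "i \<in> I" for i
  proof -
    have "star (g i) * P = star (g i)" by (rule support_absorb[OF P]) (use that in blast)
    from arg_cong[OF this, of star] show ?thesis
      by (simp only: star_mult star_star projection_star[OF P(1)])
  qed
  have "star (g j) * (e i - u i) = 0" if i: "i \<in> I" and j: "j \<in> I" for i j
  proof -
    have eu: "e j * u i = 0" unfolding e_def mult.assoc cross[OF j i] by simp
    have ue': "star (u j) * e i = 0" unfolding e_def mult.assoc[symmetric] uu_star[OF i j] by simp
    have "star (g j) * (e i - u i) = e j * e i - e j * u i + (star (u j) * e i - star (u j) * u i)"
      unfolding g_def by (simp add: star_add e_star algebra_simps)
    also have "\<dots> = e j * e i - star (u j) * u i" unfolding eu ue' by simp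
    also have "\<dots> = 0"
    proof (cases "i = j")
      case True
      then show ?thesis using ee[OF j] by (simp add: e_def)
    next
      case False
      have "e j * e i = star (u j) * (u j * star (u i)) * u i" unfolding e_def by (simp only: mult.assoc)
      then show ?thesis using initial[OF j i] final[OF j i] False by simp
    qed
    finally show ?thesis .
  qed
  then have Pd: "P * (e i - u i) = 0" if "i \<in> I" for i using P(2) that by blast
  have Pe: "2 *\<^sub>R (P * e i) = g i" and Pu: "2 *\<^sub>R (P * u i) = g i" if "i \<in> I" for i
  proof -
    have "P * e i = P * u i" using Pd[OF that] by (simp add: right_diff_distrib)
    moreover have "P * e i + P * u i = g i" using Pg[OF that] by (simp add: g_def distrib_left)
    ultimately show "2 *\<^sub>R (P * e i) = g i" "2 *\<^sub>R (P * u i) = g i" by (simp_all add: scaleR_2)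
  qed
  define v where "v = 2 *\<^sub>R (F * P * E)"
  have v_star: "star v = 2 *\<^sub>R (E * P * F)"
    unfolding v_def by (simp add: star_scaleR star_mult st projection_star[OF P(1)] mult.assoc)
  have ve: "v * e i = u i" if "i \<in> I" for i
  proof -
    have "v * e i = F * (2 *\<^sub>R (P * e i))" unfolding v_def by (simp add: mult.assoc Ee[OF that])
    then show ?thesis unfolding Pe[OF that] by (simp add: g_def distrib_left Fe[OF that] Fu[OF that])
  qed
  have vu: "star v * u i = e i" if "i \<in> I" for i
  proof -
    have "star v * u i = E * (2 *\<^sub>R (P * u i))" unfolding v_star by (simp add: mult.assoc Fu[OF that])
    then show ?thesis unfolding Pu[OF that] by (simp add: g_def distrib_left Ee[OF that] Eu[OF that])
  qed
  have "u i * (star v * v - E) = 0" if "i \<in> I" for i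
  proof -
    have "(star v * v - E) * e i = 0" using that by (simp add: left_diff_distrib mult.assoc ve vu Ee)
    then have "star ((star v * v - E) * e i) = 0" by simp
    then have "e i * (star v * v - E) = 0" by (simp add: star_mult star_diff star_star e_star st)
    then have "u i * e i * (star v * v - E) = 0" by (simp add: mult.assoc)
    then show ?thesis unfolding ue[OF that] .
  qed
  then have "E * (star v * v - E) = 0" using E(2) by blast
  moreover have "E * star v = star v" unfolding v_star by (simp add: projection_idem_left[OF E(1)] mult.assoc)
  ultimately have 1: "star v * v = E" by (simp add: right_diff_distrib EE flip: mult.assoc)
  have "star (u i) * (v * star v - F) = 0" if "i \<in> I" for i
  proof -
    have "(v * star v - F) * u i = 0" using that by (simp add: left_diff_distrib mult.assoc ve vu Fu)
    then have "star ((v * star v - F) * u i) = 0" by simp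
    then show ?thesis by (simp add: star_mult star_diff star_star st)
  qed
  then have "F * (v * star v - F) = 0" using F(2) by blast
  moreover have "F * v = v" unfolding v_def by (simp add: projection_idem_left[OF F(1)] mult.assoc)
  ultimately have 2: "v * star v = F" by (simp add: right_diff_distrib FF flip: mult.assoc)
  from 1 2 show ?thesis by (rule that)
qed

lemma orthonormal_right_mult:
  fixes u :: "'b \<Rightarrow> 'a::cstar_algebra"
  assumes q: "projection q" and orth: "\<And>i j. i \<in> I \<Longrightarrow> j \<in> I \<Longrightarrow> star (u i) * u j = (if i = j then q else 0)"
    and i: "i \<in> I"
  shows "u i * q = u i"
  by (rule partial_isometry_initial[OF q]) (simp add: orth[OF i i] projection_idem[OF q])

lemma orthonormal_sum_projection:
  fixes u :: "'b \<Rightarrow> 'a::cstar_algebra"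
  assumes q: "projection q" and orth: "\<And>i j. i \<in> I \<Longrightarrow> j \<in> I \<Longrightarrow> star (u i) * u j = (if i = j then q else 0)"
    and fin: "finite I"
  shows "projection (\<Sum>i\<in>I. u i * star (u i))"
    and "\<And>j. j \<in> I \<Longrightarrow> (\<Sum>i\<in>I. u i * star (u i)) * u j = u j"
    and "\<And>j. j \<in> I \<Longrightarrow> star (u j) * (\<Sum>i\<in>I. u i * star (u i)) = star (u j)"
proof -
  let ?S = "\<Sum>i\<in>I. u i * star (u i)"
  show Su: "?S * u j = u j" if "j \<in> I" for j
  proof -
    have "?S * u j = (\<Sum>i\<in>I. if i = j then u i * q else 0)"
      unfolding sum_distrib_right by (rule sum.cong) (simp_all add: mult.assoc orth[OF _ that])
    also have "\<dots> = u j * q" using that fin by simp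
    finally show ?thesis using orthonormal_right_mult[OF q orth that] by simp
  qed
  have sa: "star ?S = ?S" by (simp add: star_sum star_mult star_star)
  show "star (u j) * ?S = star (u j)" if "j \<in> I" for j
    using arg_cong[OF Su[OF that], of star] by (simp only: star_mult sa)
  have "?S * ?S = ?S"
    unfolding sum_distrib_left[of ?S] by (rule sum.cong) (simp_all add: mult.assoc[symmetric] Su)
  then show "projection ?S" using sa by (simp add: projection_def)
qed

text \<open>An infinite sequence of matrix units would give a proper isometry: a partial isometry from the
  even to the odd positions, followed by one from the odd positions to the even ones except \<open>0\<close>.
  The detour over the odd positions is taken because only partial isometries between orthogonal
  projections can be glued.\<close>

lemma star_finite_no_infinite_orthonormal:
  fixes u :: "nat \<Rightarrow> 'a::cstar_algebra"
  assumes baer: "baer_star_ring TYPE('a)" and finite: "star_finite TYPE('a)"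
    and q: "projection q" and orth: "\<And>i j. star (u i) * u j = (if i = j then q else 0)"
  shows "q = 0"
proof -
  have uq: "u i * q = u i" for i
    by (rule orthonormal_right_mult[OF q, of UNIV u]) (simp_all add: orth)
  have qu: "q * star (u i) = star (u i)" for i
    using arg_cong[OF uq[of i], of star] by (simp only: star_mult projection_star[OF q])
  have zero_iff: "u a * star (u b) * y = 0 \<longleftrightarrow> star (u b) * y = 0" for a b y
  proof
    assume "u a * star (u b) * y = 0"
    then have "star (u a) * (u a * star (u b) * y) = 0" by simp
    then have "(star (u a) * u a) * star (u b) * y = 0" by (simp only: mult.assoc)
    then show "star (u b) * y = 0" by (simp add: orth qu)
  qed (simp add: mult.assoc)
  have support: "\<exists>S::'a. projection S \<and> (\<forall>y. S * y = 0 \<longleftrightarrow> (\<forall>i. star (u (a i)) * y = 0))"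
    for a :: "nat \<Rightarrow> nat"
  proof -
    obtain S :: 'a where "projection S" "\<And>y. S * y = 0 \<longleftrightarrow> (\<forall>s\<in>range (\<lambda>i. star (u (a i))). s * y = 0)"
      using baer_support[OF baer, of "range (\<lambda>i. star (u (a i)))"] by blast
    then show ?thesis by (intro exI[of _ S]) simp
  qed
  have move: "\<exists>v. star v * v = E \<and> v * star v = F"
    if inj: "inj a" "inj b" and disj: "\<And>i j. a i \<noteq> b j"
      and E: "projection E" "\<And>y. E * y = 0 \<longleftrightarrow> (\<forall>i. star (u (a i)) * y = 0)"
      and F: "projection F" "\<And>y. F * y = 0 \<longleftrightarrow> (\<forall>i. star (u (b i)) * y = 0)"
    for a b :: "nat \<Rightarrow> nat" and E F
  proof -
    define g where "g i = u (b i) * star (u (a i))" for i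
    have g_star: "star (g i) = u (a i) * star (u (b i))" for i
      unfolding g_def by (simp add: star_mult star_star)
    have mid: "x * star (u k) * (u l * y) = (if k = l then x * q * y else 0)" for x y k l
    proof -
      have "x * star (u k) * (u l * y) = x * (star (u k) * u l) * y" by (simp only: mult.assoc)
      then show ?thesis by (simp add: orth)
    qed
    have "\<exists>v. star v * v = E \<and> v * star v = F"
    proof (rule glue_partial_isometries[OF baer, of UNIV g E F])
      fix i j :: nat
      have "star (g i) * g i = u (a i) * star (u (a i))" unfolding g_star unfolding g_def mid by (simp add: uq)
      moreover have "projection (u (a i) * star (u (a i)))"
        using orthonormal_sum_projection(1)[OF q, of "{a i}" u] by (simp add: orth)
      ultimately show "projection (star (g i) * g i)" by simp
      show "g i * star (g j) = 0" if "i \<noteq> j"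
        unfolding g_star unfolding g_def mid using that inj by (simp add: inj_eq)
      show "star (g i) * g j = 0" if "i \<noteq> j"
        unfolding g_star unfolding g_def mid using that inj by (simp add: inj_eq)
      show "g i * g j = 0" unfolding g_def mid by (simp add: disj)
      show "E * y = 0 \<longleftrightarrow> (\<forall>i\<in>UNIV. g i * y = 0)" for y unfolding g_def zero_iff E(2) by simp
      show "F * y = 0 \<longleftrightarrow> (\<forall>i\<in>UNIV. star (g i) * y = 0)" for y unfolding g_star zero_iff F(2) by simp
    qed (use E(1) F(1) in auto)
    then show ?thesis .
  qed
  obtain E :: 'a where E: "projection E" "\<And>y. E * y = 0 \<longleftrightarrow> (\<forall>i. star (u (2 * i)) * y = 0)"
    using support[of "\<lambda>i. 2 * i"] by blast
  obtain F :: 'a where F: "projection F" "\<And>y. F * y = 0 \<longleftrightarrow> (\<forall>i. star (u (2 * i + 1)) * y = 0)"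
    using support[of "\<lambda>i. 2 * i + 1"] by blast
  obtain E' :: 'a where E': "projection E'" "\<And>y. E' * y = 0 \<longleftrightarrow> (\<forall>i. star (u (2 * i + 2)) * y = 0)"
    using support[of "\<lambda>i. 2 * i + 2"] by blast
  have "\<exists>v. star v * v = E \<and> v * star v = F"
    by (rule move[OF _ _ _ E F]) (auto simp: inj_def, presburger)
  then obtain U where U: "star U * U = E" "U * star U = F" by blast
  have "\<exists>v. star v * v = F \<and> v * star v = E'"
    by (rule move[OF _ _ _ F E']) (auto simp: inj_def, presburger)
  then obtain V where V: "star V * V = F" "V * star V = E'" by blast
  have EE: "E * E = E" "E' * E' = E'" using E(1) E'(1) by (auto intro: projection_idem)
  have "E * (1 - E) = 0" by (simp add: right_diff_distrib EE)
  then have *: "star (u (2 * i)) * (1 - E) = 0" for i using E(2) by blast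
  have "star (u (2 * i + 2)) * (1 - E) = 0" for i using *[of "i + 1"] by simp
  then have "E' * (1 - E) = 0" using E'(2) by blast
  have VE': "star V * E' = star V"
    by (rule partial_isometry_initial[OF E'(1)]) (simp add: star_star V(2) EE)
  have "star V * (1 - E) = star V * (E' * (1 - E))" unfolding mult.assoc[symmetric] VE' ..
  then have V1: "star V * (1 - E) = 0" unfolding \<open>E' * (1 - E) = 0\<close> by simp
  have 1: "(1 - E) * V = 0"
    using arg_cong[OF V1, of star] by (simp add: star_mult star_diff star_star projection_star[OF E(1)])
  have UE: "U * E = U" by (rule partial_isometry_initial[OF E(1)]) (simp add: U(1) EE)
  then have U1: "U * (1 - E) = 0" by (simp add: right_diff_distrib)
  have U1': "(1 - E) * star U = 0"
    using arg_cong[OF U1, of star] by (simp add: star_mult star_diff projection_star[OF E(1)])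
  have E1: "(1 - E) * (1 - E) = 1 - E" by (rule projection_idem[OF projection_complement[OF E(1)]])
  define X where "X = V * U + (1 - E)"
  have X_star: "star X = star U * star V + (1 - E)"
    unfolding X_def by (simp add: star_add star_mult star_diff projection_star[OF E(1)])
  have "star X * X = star U * (star V * V) * U + star U * (star V * (1 - E)) + (1 - E) * V * U
      + (1 - E) * (1 - E)"
    unfolding X_star unfolding X_def 
    by (simp only: distrib_left distrib_right mult.assoc) (simp only: add.assoc add.left_commute add.commute)
  also have "star U * (star V * V) * U = (star U * U) * (star U * U)"
    unfolding V(1) U(2)[symmetric] by (simp only: mult.assoc)
  finally have "star X * X = 1" unfolding V1 1 E1 U(1) EE by simp
  then have XX: "X * star X = 1" using finite unfolding star_finite_def by blast
  have "X * star X = V * (U * star U) * star V + V * (U * (1 - E)) + (1 - E) * star U * star V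
      + (1 - E) * (1 - E)"
    unfolding X_star unfolding X_def 
    by (simp only: distrib_left distrib_right mult.assoc) (simp only: add.assoc add.left_commute add.commute)
  also have "V * (U * star U) * star V = (V * star V) * (V * star V)"
    unfolding U(2) V(1)[symmetric] by (simp only: mult.assoc)
  finally have "E' + (1 - E) = 1" unfolding U1 U1' E1 V(2) EE XX by simp
  then have "E' = E" by (simp add: algebra_simps)
  moreover have "E' * u 0 = 0" unfolding E'(2) by (simp add: orth)
  ultimately have "star (u (2 * 0)) * u 0 = 0" using E(2) by blast
  then show ?thesis by (simp add: orth)
qed

text \<open>A maximal orthogonal family of central projections over which \<open>e\<close> has a copy below \<open>g\<close> exhausts
  \<open>w\<close>, and the copies over its members are glued together.\<close>

lemma abelian_copy_below:
  fixes e g w :: "'a::cstar_algebra"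
  assumes baer: "baer_star_ring TYPE('a)" and faithful: "faithful_projection e"
    and e: "abelian_projection e" and w: "central_projection w" and g: "projection g"
    and orth: "g * (w * e) = 0"
    and nonzero: "\<And>y. central_projection y \<Longrightarrow> y \<noteq> 0 \<Longrightarrow> w * y = y \<Longrightarrow> y * g \<noteq> 0"
  shows "\<exists>u. star u * u = w * e \<and> g * u = u"
proof -
  have pe: "projection e" using e by (rule abelian_projection_projection)
  have gg: "g * g = g" using g by (rule projection_idem)
  define P where "P y \<longleftrightarrow> (\<exists>u. star u * u = y * e \<and> g * u = u)" for y
  have dense: "\<exists>y'. central_projection y' \<and> y' \<noteq> 0 \<and> y * y' = y' \<and> P y'"
    if y: "central_projection y" "y \<noteq> 0" "w * y = y" for y
  proof -
    have "\<exists>a. y * g * a * e \<noteq> 0"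
      using faithful_mult_eq_zero[OF baer faithful, of "y * g"] nonzero[OF y] by blast
    then obtain a where a: "y * g * a * e \<noteq> 0" by blast
    define x where "x = y * g * a * e"
    have xe: "x * e = x" unfolding x_def by (simp only: mult.assoc projection_idem[OF pe])
    have yx: "y * x = x"
      unfolding x_def mult.assoc by (rule projection_idem_left[OF central_projection_projection[OF y(1)]])
    have "g * (y * g) = y * g"
      unfolding mult.assoc[symmetric] central_projection_commute[OF y(1), of g] by (simp only: mult.assoc gg)
    then have "g * (y * g) * a * e = y * g * a * e" by simp
    then have gx: "g * x = x" unfolding x_def by (simp only: mult.assoc)
    obtain t y' where y': "central_projection y'" "y' \<noteq> 0" "y * y' = y'"
      and "t * e = t" and t: "star (x * t) * (x * t) = y' * e"
      using a unfolding x_def[symmetric] by (rule abelian_local_copy[OF baer e xe _ y(1) yx])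
    have "g * (x * t) = x * t" unfolding mult.assoc[symmetric] gx ..
    then have "P y'" unfolding P_def using t by blast
    then show ?thesis using y' by blast
  qed
  obtain Y where Y: "\<And>y. y \<in> Y \<Longrightarrow> central_projection y \<and> w * y = y \<and> P y"
    and Y_orth: "\<And>y y'. y \<in> Y \<Longrightarrow> y' \<in> Y \<Longrightarrow> y \<noteq> y' \<Longrightarrow> y * y' = 0"
    and Y_sup: "\<And>x. w * x = 0 \<longleftrightarrow> (\<forall>y\<in>Y. y * x = 0)"
    using baer_exhaust_central[OF baer w, of P] dense by blast
  define u where "u y = (SOME u. star u * u = y * e \<and> g * u = u)" for y
  have u: "star (u y) * u y = y * e" "g * u y = u y" if "y \<in> Y" for y
  proof -
    have "\<exists>u. star u * u = y * e \<and> g * u = u" using Y[OF that] unfolding P_def by blast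
    from someI_ex[OF this] show "star (u y) * u y = y * e" "g * u y = u y" unfolding u_def by auto
  qed
  have Yc: "central_projection y" and wY: "w * y = y" if "y \<in> Y" for y using Y[OF that] by auto
  have Yp: "projection y" if "y \<in> Y" for y using Yc[OF that] by (rule central_projection_projection)
  have ye: "projection (y * e)" if "y \<in> Y" for y by (rule projection_central_mult[OF Yc[OF that] pe])
  have uy: "u y * y = u y" if "y \<in> Y" for y
    by (rule partial_isometry_initial[OF Yp[OF that]])
       (simp add: u(1) that mult.assoc central_projection_commute[OF Yc[OF that]] projection_idem_left[OF Yp[OF that]])
  have uye: "u y * (y * e) = u y" if "y \<in> Y" for y
    by (rule partial_isometry_initial[OF ye[OF that]]) (simp add: u(1) that projection_idem[OF ye[OF that]])
  have yu: "y * u y = u y" if "y \<in> Y" for y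
    using uy[OF that] central_projection_commute[OF Yc[OF that], of "u y"] by simp
  have eg: "(w * e) * g = 0"
    by (rule projection_orthogonal_sym[OF g projection_central_mult[OF w pe] orth])
  have we: "projection (w * e)" by (rule projection_central_mult[OF w pe])
  obtain F :: 'a where F: "projection F" "\<And>x. F * x = 0 \<longleftrightarrow> (\<forall>s\<in>(\<lambda>y. star (u y)) ` Y. s * x = 0)"
    using baer_support[OF baer, of "(\<lambda>y. star (u y)) ` Y"] by blast
  have "\<exists>v. star v * v = w * e \<and> v * star v = F"
  proof (rule glue_partial_isometries[OF baer, of Y u "w * e" F])
    fix y assume y: "y \<in> Y"
    show "projection (star (u y) * u y)" using ye[OF y] u(1)[OF y] by simp
    fix y' assume y': "y' \<in> Y"
    have "u y * star (u y') = (u y * y) * star (u y' * y')" unfolding uy[OF y] uy[OF y'] ..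
    also have "\<dots> = u y * (y * y') * star (u y')"
      unfolding star_mult projection_star[OF Yp[OF y']] by (simp only: mult.assoc)
    finally show "u y * star (u y') = 0" if "y \<noteq> y'" using Y_orth[OF y y' that] by simp
    have "star (u y) * u y' = star (y * u y) * (y' * u y')" unfolding yu[OF y] yu[OF y'] ..
    also have "\<dots> = star (u y) * (y * y') * u y'"
      unfolding star_mult projection_star[OF Yp[OF y]] by (simp only: mult.assoc)
    finally show "star (u y) * u y' = 0" if "y \<noteq> y'" using Y_orth[OF y y' that] by simp
    have "u y * u y' = u y * (y * e) * (g * u y')" unfolding uye[OF y] u(2)[OF y'] ..
    also have "\<dots> = u y * ((w * y) * e * g) * u y'" unfolding wY[OF y] by (simp only: mult.assoc)
    also have "(w * y) * e * g = y * ((w * e) * g)"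
      unfolding central_projection_commute[OF Yc[OF y], of w] by (simp only: mult.assoc)
    finally show "u y * u y' = 0" unfolding eg by simp
  next
    fix x
    have "y * (e * x) = 0 \<longleftrightarrow> u y * x = 0" if "y \<in> Y" for y
    proof
      assume "y * (e * x) = 0"
      then have "u y * (y * e) * x = 0" by (simp add: mult.assoc)
      then show "u y * x = 0" unfolding uye[OF that] .
    next
      assume "u y * x = 0"
      then have "star (u y) * u y * x = 0" by (simp add: mult.assoc)
      then show "y * (e * x) = 0" unfolding u(1)[OF that] by (simp only: mult.assoc)
    qed
    then show "w * e * x = 0 \<longleftrightarrow> (\<forall>y\<in>Y. u y * x = 0)" unfolding mult.assoc Y_sup by blast
    show "F * x = 0 \<longleftrightarrow> (\<forall>y\<in>Y. star (u y) * x = 0)" unfolding F(2) by blast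
  qed (use we F(1) in auto)
  then obtain v where v: "star v * v = w * e" "v * star v = F" by blast
  have "star (u y) * (1 - g) = 0" if "y \<in> Y" for y
    using arg_cong[OF u(2)[OF that], of star] by (simp add: star_mult right_diff_distrib projection_star[OF g])
  then have "F * (1 - g) = 0" unfolding F(2) by blast
  then have Fg: "F * g = F" by (simp add: right_diff_distrib)
  have gF: "g * F = F"
    using arg_cong[OF Fg, of star] by (simp only: star_mult projection_star[OF g] projection_star[OF F(1)])
  have "v * (w * e) = v" by (rule partial_isometry_initial[OF we]) (simp add: v projection_idem[OF we])
  then have Fv: "F * v = v" unfolding v[symmetric] by (simp only: mult.assoc)
  have "g * v = g * F * v" unfolding mult.assoc Fv ..
  also have "\<dots> = v" unfolding gF Fv ..
  finally show ?thesis using v(1) by blast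
qed

text \<open>The \<open>v i\<close> are partial isometries with common initial projection \<open>z e\<close> and orthogonal final
  projections with sum \<open>z\<close>, so that the \<open>v i (v j)\<^sup>*\<close> are matrix units.  They identify \<open>z A\<close> with the
  algebra of \<open>n\<close> by \<open>n\<close> matrices over \<open>z e A e\<close>.\<close>

definition matrix_frame :: "'a::star_ring \<Rightarrow> 'a \<Rightarrow> nat \<Rightarrow> (nat \<Rightarrow> 'a) \<Rightarrow> bool" where
  "matrix_frame e z n v \<longleftrightarrow> central_projection z \<and>
     (\<forall>i<n. \<forall>j<n. star (v i) * v j = (if i = j then z * e else 0)) \<and>
     (\<Sum>i<n. v i * star (v i)) = z"

text \<open>If no nonzero central projection below \<open>w\<close> had a frame, every finite family of orthogonal copies of
  \<open>w e\<close> would leave room for another one.\<close>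

lemma matrix_frame_exists:
  fixes e w :: "'a::cstar_algebra"
  assumes baer: "baer_star_ring TYPE('a)" and finite: "star_finite TYPE('a)"
    and faithful: "faithful_projection e" and e: "abelian_projection e"
    and w: "central_projection w" and w_nonzero: "w \<noteq> 0"
  shows "\<exists>z n v. z \<noteq> 0 \<and> w * z = z \<and> matrix_frame e z n v"
proof (rule ccontr)
  assume no_frame: "\<not> ?thesis"
  have pe: "projection e" using e by (rule abelian_projection_projection)
  have wp: "projection w" using w by (rule central_projection_projection)
  define q where "q = w * e"
  have q: "projection q" unfolding q_def by (rule projection_central_mult[OF w pe])
  have wq: "w * q = q" unfolding q_def by (rule projection_idem_left[OF wp])
  define R where "R f k r \<longleftrightarrow> star r * r = q \<and> (\<forall>i<k. star (f i) * r = 0) \<and> (k = 0 \<longrightarrow> r = q)"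
    for f :: "nat \<Rightarrow> 'a" and k r
  have step: "\<exists>r. R f k r" if f: "\<And>i. i < k \<Longrightarrow> R f i (f i)" for f k
  proof (cases "k = 0")
    case True
    then show ?thesis
      unfolding R_def using projection_idem[OF q] projection_star[OF q] by (intro exI[of _ q]) simp
  next
    case False
    have orth: "star (f i) * f j = (if i = j then q else 0)" if "i \<in> {..<k}" "j \<in> {..<k}" for i j
    proof -
      consider "i = j" | "i < j" | "j < i" by linarith
      then show ?thesis
      proof cases
        case 1
        then show ?thesis using f[of j] that unfolding R_def by simp
      next
        case 2
        then show ?thesis using f[of j] that unfolding R_def by simp
      next
        case 3
        then have "star (f j) * f i = 0" using f[of i] that unfolding R_def by simp
        from arg_cong[OF this, of star] show ?thesis using 3 by (simp add: star_mult star_star)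
      qed
    qed
    have fq: "f i * q = f i" if "i \<in> {..<k}" for i by (rule orthonormal_right_mult[OF q orth that])
    define S where "S = (\<Sum>i\<in>{..<k}. f i * star (f i))"
    have S: "projection S" unfolding S_def by (rule orthonormal_sum_projection(1)[OF q orth]) auto
    have Sf: "S * f i = f i" and fS: "star (f i) * S = star (f i)" if "i \<in> {..<k}" for i
      unfolding S_def using orthonormal_sum_projection(2,3)[OF q orth _ that] by auto
    have fw: "f i * w = f i" if "i \<in> {..<k}" for i
    proof -
      have "f i * q * w = f i * q"
        unfolding mult.assoc central_projection_commute[OF w, of q] wq ..
      then show ?thesis unfolding fq[OF that] .
    qed
    have wf: "w * f i = f i" if "i \<in> {..<k}" for i
      using fw[OF that] central_projection_commute[OF w, of "f i"] by simp
    have wS: "w * S = S"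
      unfolding S_def sum_distrib_left by (rule sum.cong) (simp_all add: mult.assoc[symmetric] wf)
    have Sw: "S * w = S" using wS central_projection_commute[OF w, of S] by simp
    define g where "g = w - S"
    have g: "projection g"
      unfolding g_def projection_def
      by (simp add: star_diff projection_star[OF S] projection_star[OF wp] left_diff_distrib right_diff_distrib
          wS Sw projection_idem[OF S] projection_idem[OF wp])
    have "f 0 = q" using f[of 0] False unfolding R_def by simp
    then have "S * q = q" using Sf[of 0] False by simp
    then have gq: "g * (w * e) = 0" unfolding q_def[symmetric] g_def by (simp add: left_diff_distrib wq)
    have "y * g \<noteq> 0" if y: "central_projection y" "y \<noteq> 0" "w * y = y" for y
    proof
      assume "y * g = 0"
      then have yS: "y * S = y"
        using y(3) central_projection_commute[OF w, of y] by (simp add: g_def right_diff_distrib)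
      have yp: "projection y" using y(1) by (rule central_projection_projection)
      have "star (y * f i) * (y * f j) = (if i = j then y * e else 0)" if "i < k" "j < k" for i j
      proof -
        have "star (y * f i) * (y * f j) = star (f i) * (y * (y * f j))"
          by (simp only: star_mult projection_star[OF yp] mult.assoc)
        also have "\<dots> = star (f i) * (y * f j)" unfolding projection_idem_left[OF yp] ..
        also have "\<dots> = y * (star (f i) * f j)"
          unfolding mult.assoc[symmetric] central_projection_commute[OF y(1), of "star (f i)"] ..
        also have "\<dots> = (if i = j then y * q else 0)" using orth that by simp
        also have "y * q = y * e"
          unfolding q_def mult.assoc[symmetric] using y(3) central_projection_commute[OF w, of y] by simp
        finally show ?thesis .
      qed
      moreover have "(\<Sum>i<k. y * f i * star (y * f i)) = y"
      proof -
        have "y * f i * star (y * f i) = y * (f i * star (f i))" for i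
        proof -
          have "y * f i * star (y * f i) = y * (f i * star (f i) * y)"
            by (simp only: star_mult projection_star[OF yp] mult.assoc)
          then show ?thesis
            unfolding central_projection_commute[OF y(1), of "f i * star (f i)"] projection_idem_left[OF yp] .
        qed
        then show ?thesis using yS unfolding S_def sum_distrib_left by simp
      qed
      ultimately have "matrix_frame e y k (\<lambda>i. y * f i)" unfolding matrix_frame_def using y(1) by simp
      then show False using no_frame y(2,3) by blast
    qed
    then obtain u where u: "star u * u = w * e" "g * u = u"
      using abelian_copy_below[OF baer faithful e w g gq] by blast
    have "star (f i) * u = 0" if "i < k" for i
    proof -
      have "star (f i) * w = star (f i)"
        using arg_cong[OF wf, of i star] that by (simp add: star_mult projection_star[OF wp])
      then have "star (f i) * g = 0" unfolding g_def using fS that by (simp add: right_diff_distrib)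
      then have "star (f i) * g * u = 0" by simp
      then show ?thesis unfolding mult.assoc u(2) .
    qed
    then show ?thesis unfolding R_def q_def using u(1) False by blast
  qed
  have "\<exists>f. \<forall>k. R f k (f k)"
  proof (rule dependent_wellorder_choice)
    show "R f k r = R f' k r" if "\<And>i. i < k \<Longrightarrow> f i = f' i" for r f f' and k :: nat
      using that unfolding R_def by simp
  qed (rule step)
  then obtain f where f: "\<And>k. R f k (f k)" by blast
  have "star (f i) * f j = (if i = j then q else 0)" for i j
  proof -
    consider "i = j" | "i < j" | "j < i" by linarith
    then show ?thesis
    proof cases
      case 3
      then have "star (f j) * f i = 0" using f[of i] unfolding R_def by simp
      from arg_cong[OF this, of star] show ?thesis using 3 by (simp add: star_mult star_star)
    qed (use f[of j] in \<open>auto simp: R_def\<close>)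
  qed
  then have "q = 0" by (rule star_finite_no_infinite_orthonormal[OF baer finite q])
  then show False using faithful_central_mult_eq_zero[OF faithful w] w_nonzero unfolding q_def by blast
qed

section \<open>Regular perturbations by projections\<close>

text \<open>Pass from \<open>f\<close> to \<open>f + v v\<^sup>*\<close>, with \<open>b = x - p\<close> injective on \<open>f\<close>.  Over a point, injectivity on
  \<open>f\<close> makes the kernel of the larger compression of \<open>b\<close> at most one-dimensional, and a kernel vector
  is determined by its component in \<open>v v\<^sup>*\<close>.  The compressions of \<open>b\<close> and \<open>b - v v\<^sup>*\<close> cannot both
  have a kernel: rescaled by elements of the commutative corner of \<open>e\<close> (the terms \<open>\<sigma>\<close> and \<open>\<tau>\<close>
  below), a kernel vector of the one and a kernel vector of the other agree in that component, hence
  agree, hence are annihilated by \<open>v v\<^sup>*\<close>.  So \<open>v v\<^sup>*\<close> is subtracted exactly over the central cover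
  \<open>z\<close> of the kernel.\<close>

lemma injective_compression_extend:
  fixes e f v x p :: "'a::cstar_algebra"
  assumes baer: "baer_star_ring TYPE('a)" and faithful: "faithful_projection e"
    and e: "abelian_projection e"
    and f: "projection f" and v: "projection (v * star v)" and ve: "v * e = v" and fv: "f * v = 0"
    and vv: "v * star v * v = v"
    and p: "projection p" "f * p = p"
    and inj: "\<And>y. f * y = y \<Longrightarrow> f * ((x - p) * y) = 0 \<Longrightarrow> y = 0"
  shows "\<exists>p'. projection p' \<and> (f + v * star v) * p' = p' \<and>
    (\<forall>y. (f + v * star v) * y = y \<longrightarrow> (f + v * star v) * ((x - p') * y) = 0 \<longrightarrow> y = 0)"
proof -
  have pe: "projection e" using e by (rule abelian_projection_projection)
  define \<epsilon> where "\<epsilon> = v * star v"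
  have \<epsilon>: "projection \<epsilon>" unfolding \<epsilon>_def by (rule v)
  have \<epsilon>\<epsilon>: "\<epsilon> * \<epsilon> = \<epsilon>" using \<epsilon> by (rule projection_idem)
  have ff: "f * f = f" using f by (rule projection_idem)
  have f\<epsilon>: "f * \<epsilon> = 0" unfolding \<epsilon>_def mult.assoc[symmetric] fv by simp
  have \<epsilon>f: "\<epsilon> * f = 0" by (rule projection_orthogonal_sym[OF f \<epsilon> f\<epsilon>])
  have pf: "p * f = p" by (rule projection_below_sym[OF f p])
  have p\<epsilon>: "p * \<epsilon> = 0"
  proof -
    have "p * \<epsilon> = p * (f * \<epsilon>)" unfolding mult.assoc[symmetric] pf ..
    then show ?thesis unfolding f\<epsilon> by simp
  qed
  have \<epsilon>p: "\<epsilon> * p = 0" by (rule projection_orthogonal_sym[OF p(1) \<epsilon> p\<epsilon>])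
  define g where "g = f + \<epsilon>"
  have gf: "f * g = f" and g\<epsilon>: "\<epsilon> * g = \<epsilon>"
    unfolding g_def by (simp_all add: distrib_left ff f\<epsilon> \<epsilon>f \<epsilon>\<epsilon>)
  have g: "projection g"
    unfolding projection_def g_def
    by (simp add: star_add projection_star[OF f] projection_star[OF \<epsilon>] distrib_left distrib_right ff f\<epsilon> \<epsilon>f \<epsilon>\<epsilon>)
  have e_v: "e * star v = star v"
    using arg_cong[OF ve, of star] by (simp only: star_mult projection_star[OF pe])
  have v\<epsilon>: "star v * \<epsilon> = star v"
    using arg_cong[OF vv, of star] unfolding \<epsilon>_def by (simp add: star_mult star_star mult.assoc)
  have \<epsilon>_zero: "\<epsilon> * y = 0" if "star v * y = 0" for y unfolding \<epsilon>_def mult.assoc that by simp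
  have v_zero: "star v * y = 0" if "\<epsilon> * y = 0" for y
  proof -
    have "star v * y = star v * (\<epsilon> * y)" unfolding mult.assoc[symmetric] v\<epsilon> ..
    then show ?thesis unfolding that by simp
  qed
  \<comment> \<open>Both compressions agree with that of \<open>x - p\<close> on vectors without component in \<open>\<epsilon>\<close>.\<close>
  have inj': "y = 0" if gy: "g * y = y" and \<epsilon>y: "\<epsilon> * y = 0" and zero: "f * ((x - p) * y) = 0" for y
  proof (rule inj[OF _ zero])
    show "f * y = y" using gy \<epsilon>y unfolding g_def by (simp add: distrib_right)
  qed
  obtain k0 :: 'a where k0: "projection k0"
    "\<And>y. k0 * y = 0 \<longleftrightarrow> (\<forall>s\<in>{g * (x - p), 1 - g}. s * y = 0)"
    using baer_support[OF baer, of "{g * (x - p), 1 - g}"] by blast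
  define k where "k = 1 - k0"
  have "k0 * k = 0" unfolding k_def by (simp add: right_diff_distrib projection_idem[OF k0(1)])
  then have "g * (x - p) * k = 0" "(1 - g) * k = 0" using k0(2) by blast+
  then have bk: "g * ((x - p) * k) = 0" and gk: "g * k = k"
    by (simp only: mult.assoc) (use \<open>(1 - g) * k = 0\<close> in \<open>simp add: left_diff_distrib\<close>)
  have kernel: "k * y = y" if "g * y = y" "g * ((x - p) * y) = 0" for y
  proof -
    have "g * (x - p) * y = 0" "(1 - g) * y = 0"
      using that(2) by (simp only: mult.assoc) (simp add: left_diff_distrib that(1))
    then have "k0 * y = 0" using k0(2) by blast
    then show ?thesis unfolding k_def by (simp add: left_diff_distrib)
  qed
  obtain z :: 'a where z: "central_projection z" "\<And>y. z * y = 0 \<longleftrightarrow> (\<forall>a. k * a * y = 0)" "z * k = k"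
    using baer_central_cover[OF baer, of k] by blast
  have zp: "projection z" using z(1) by (rule central_projection_projection)
  note zc = central_projection_commute[OF z(1)]
  define p' where "p' = p + z * \<epsilon>"
  have z\<epsilon>: "projection (z * \<epsilon>)" by (rule projection_central_mult[OF z(1) \<epsilon>])
  have p_z\<epsilon>: "p * (z * \<epsilon>) = 0" unfolding mult.assoc[symmetric] zc[of p] by (simp only: mult.assoc p\<epsilon>) simp
  have z\<epsilon>_p: "z * \<epsilon> * p = 0" by (simp only: mult.assoc \<epsilon>p) simp
  have p': "projection p'"
    unfolding projection_def p'_def
    by (simp add: star_add projection_star[OF p(1)] projection_star[OF z\<epsilon>] distrib_left distrib_right
        p_z\<epsilon> z\<epsilon>_p projection_idem[OF p(1)] projection_idem[OF z\<epsilon>])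
  have gp': "g * p' = p'"
  proof -
    have "g * (z * \<epsilon>) = z * (g * \<epsilon>)" unfolding mult.assoc[symmetric] zc[of g] ..
    moreover have "g * \<epsilon> = \<epsilon>" unfolding g_def by (simp add: distrib_right f\<epsilon> \<epsilon>\<epsilon>)
    moreover have "g * p = p" unfolding g_def by (simp add: distrib_right p(2) \<epsilon>p)
    ultimately show ?thesis unfolding p'_def by (simp add: distrib_left)
  qed
  have "y = 0" if gy: "g * y = y" and zero: "g * ((x - p') * y) = 0" for y
  proof -
    have g_z: "g * (z * a) = z * (g * a)" for a
      unfolding mult.assoc[symmetric] zc[of g] ..
    have x_z: "(x - p) * (z * a) = z * ((x - p) * a)" for a
      unfolding mult.assoc[symmetric] zc[of "x - p"] ..
    have eq: "g * ((x - p) * y) = z * (\<epsilon> * y)"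
    proof -
      have "(x - p') * y = (x - p) * y - z * (\<epsilon> * y)"
        unfolding p'_def by (simp only: left_diff_distrib distrib_right mult.assoc) simp
      then have "g * ((x - p) * y) = g * (z * (\<epsilon> * y))" using zero by (simp add: right_diff_distrib)
      also have "\<dots> = z * (g * \<epsilon> * y)" unfolding g_z by (simp only: mult.assoc)
      also have "g * \<epsilon> = \<epsilon>" unfolding g_def by (simp add: distrib_right f\<epsilon> \<epsilon>\<epsilon>)
      finally show ?thesis .
    qed
    have zy: "z * y = y"
    proof -
      have "g * ((x - p) * (z * y)) = z * (g * ((x - p) * y))" unfolding x_z g_z ..
      also have "\<dots> = z * (\<epsilon> * y)" unfolding eq by (rule projection_idem_left[OF zp])
      finally have "g * ((x - p) * (y - z * y)) = 0" by (simp add: right_diff_distrib eq)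
      moreover have "g * (y - z * y) = y - z * y" by (simp add: right_diff_distrib gy g_z)
      ultimately have ky: "k * (y - z * y) = y - z * y" using kernel by blast
      have "k * (z * y) = z * k * y" unfolding mult.assoc[symmetric] zc[of k] ..
      then have "k * (y - z * y) = 0" unfolding z(3) by (simp add: right_diff_distrib)
      then show ?thesis using ky by simp
    qed
    have fy: "f * ((x - p) * (y * a)) = 0" for a
    proof -
      have "f * ((x - p) * y) = f * (g * ((x - p) * y))" by (simp only: mult.assoc[symmetric] gf)
      also have "\<dots> = f * (z * (\<epsilon> * y))" unfolding eq ..
      also have "\<dots> = z * (f * \<epsilon> * y)" unfolding mult.assoc[symmetric] zc[of f] ..
      finally have "f * ((x - p) * y) = 0" unfolding f\<epsilon> by simp
      then have "f * ((x - p) * y) * a = 0" by simp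
      then show ?thesis by (simp only: mult.assoc)
    qed
    have fk: "f * ((x - p) * (k * a)) = 0" for a
    proof -
      have "f * ((x - p) * k) = f * (g * ((x - p) * k))" by (simp only: mult.assoc[symmetric] gf)
      then have "f * ((x - p) * k) * a = 0" unfolding bk by simp
      then show ?thesis by (simp only: mult.assoc)
    qed
    have ga: "g * (k * a) = k * a" "g * (y * a) = y * a" for a
      by (simp_all only: mult.assoc[symmetric] gk gy)
    \<comment> \<open>\<open>k * (r * e * \<tau>)\<close> and \<open>y * (a * e * \<sigma>)\<close> are kernel vectors of the two compressions with the same
      component in \<open>\<epsilon>\<close>, since \<open>\<sigma>\<close> and \<open>\<tau>\<close> commute.  Their difference \<open>V\<close> vanishes, so both compressions
      annihilate the common value, and so does \<open>\<epsilon>\<close>.\<close>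
    have *: "star v * (k * r * (star v * y)) = 0" for r
    proof -
      have "star v * (k * r * (star v * y)) * a * e = 0" for a
      proof -
        define \<sigma> \<tau> where "\<sigma> = star v * (k * (r * e))" and "\<tau> = star v * (y * (a * e))"
        have \<sigma>: "e * \<sigma> = \<sigma>" "\<sigma> * e = \<sigma>" and \<tau>: "e * \<tau> = \<tau>" "\<tau> * e = \<tau>"
          unfolding \<sigma>_def \<tau>_def by (simp_all only: mult.assoc projection_idem[OF pe])
            (simp_all only: mult.assoc[symmetric] e_v)
        have \<sigma>\<tau>: "\<sigma> * \<tau> = \<tau> * \<sigma>" by (rule abelian_corner_commute[OF baer e \<sigma> \<tau>])
        define V where "V = k * (r * e * \<tau>) - y * (a * e * \<sigma>)"
        have "star v * V = \<sigma> * \<tau> - \<tau> * \<sigma>"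
          unfolding V_def \<sigma>_def \<tau>_def by (simp only: right_diff_distrib mult.assoc)
        then have "\<epsilon> * V = 0" using \<sigma>\<tau> \<epsilon>_zero by simp
        moreover have "g * V = V" unfolding V_def by (simp add: right_diff_distrib ga)
        moreover have "f * ((x - p) * V) = 0"
          unfolding V_def by (simp add: right_diff_distrib[of "x - p"] right_diff_distrib[of f] fk fy del: left_diff_distrib)
        ultimately have "V = 0" using inj'[of V] by blast
        then have W: "k * (r * e * \<tau>) = y * (a * e * \<sigma>)" unfolding V_def by simp
        have "g * ((x - p) * (k * (r * e * \<tau>))) = g * ((x - p) * k) * (r * e * \<tau>)" by (simp only: mult.assoc)
        then have b0: "g * ((x - p) * (k * (r * e * \<tau>))) = 0" unfolding bk by simp
        have "g * ((x - p) * (y * (a * e * \<sigma>))) = g * ((x - p) * y) * (a * e * \<sigma>)" by (simp only: mult.assoc)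
        also have "\<dots> = z * (\<epsilon> * y) * (a * e * \<sigma>)" unfolding eq ..
        also have "\<dots> = \<epsilon> * (z * y) * (a * e * \<sigma>)"
          unfolding mult.assoc[symmetric] zc[of \<epsilon>] ..
        also have "\<dots> = \<epsilon> * (y * (a * e * \<sigma>))" unfolding zy by (simp only: mult.assoc)
        finally have "\<epsilon> * (k * (r * e * \<tau>)) = 0" unfolding W[symmetric] b0 by simp
        then have "k * (r * e * \<tau>) = 0" using inj' ga fk by blast
        then have "star v * (k * (r * e * \<tau>)) = 0" by simp
        then have "star v * (k * (r * ((e * star v) * (y * (a * e))))) = 0"
          unfolding \<tau>_def by (simp only: mult.assoc)
        then show ?thesis unfolding e_v by (simp only: mult.assoc)
      qed
      then show ?thesis by (rule faithful_mult_eq_zero[OF baer faithful])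
    qed
    obtain c :: 'a where c: "central_projection c" "\<And>y. c * y = 0 \<longleftrightarrow> (\<forall>a. star v * k * a * y = 0)"
      "c * (star v * k) = star v * k"
      using baer_central_cover[OF baer, of "star v * k"] by blast
    note cc = central_projection_commute[OF c(1)]
    have c_comm: "s * (c * t) = c * (s * t)" for s t unfolding mult.assoc[symmetric] cc[of s] ..
    have "star v * k * a * (star v * y) = 0" for a using *[of a] by (simp only: mult.assoc)
    then have cvy: "c * (star v * y) = 0" using c(2) by blast
    have ck: "c * k = k"
    proof -
      have "star v * (k - c * k) = 0" using c(3) by (simp add: right_diff_distrib c_comm)
      then have "\<epsilon> * (k - c * k) = 0" by (rule \<epsilon>_zero)
      moreover have "g * (k - c * k) = k - c * k" by (simp add: right_diff_distrib c_comm gk)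
      moreover have "f * ((x - p) * (k - c * k)) = 0"
      proof -
        have "f * ((x - p) * (k * 1)) - c * (f * ((x - p) * (k * 1))) = 0" unfolding fk by simp
        then show ?thesis by (simp add: right_diff_distrib[of "x - p"] right_diff_distrib[of f] c_comm del: left_diff_distrib)
      qed
      ultimately have "k - c * k = 0" using inj'[of "k - c * k"] by blast
      then show ?thesis by simp
    qed
    have cy: "c * y = 0"
    proof (rule inj')
      show "g * (c * y) = c * y" by (simp only: c_comm gy)
      show "\<epsilon> * (c * y) = 0" by (rule \<epsilon>_zero) (simp only: c_comm cvy)
      have "f * ((x - p) * (y * c)) = 0" by (rule fy)
      then show "f * ((x - p) * (c * y)) = 0" unfolding cc[of y] .
    qed
    have "k * a * y = 0" for a
    proof -
      have "k * a * y = c * k * a * y" unfolding ck ..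
      also have "\<dots> = k * a * (c * y)" by (simp only: c_comm mult.assoc)
      finally show ?thesis unfolding cy by simp
    qed
    then have "z * y = 0" using z(2) by blast
    then show ?thesis unfolding zy .
  qed
  then show ?thesis using p' gp' unfolding g_def \<epsilon>_def by blast
qed

lemma matrix_frame_orthonormal:
  assumes "matrix_frame e z n v" "i \<in> {..<n}" "j \<in> {..<n}"
  shows "star (v i) * v j = (if i = j then z * e else 0)"
  using assms unfolding matrix_frame_def by blast

lemma matrix_frame_injective_perturbation:
  fixes e z x :: "'a::cstar_algebra"
  assumes baer: "baer_star_ring TYPE('a)" and faithful: "faithful_projection e"
    and e: "abelian_projection e" and frame: "matrix_frame e z n v"
  shows "\<exists>p. projection p \<and> z * p = p \<and> (\<forall>y. z * y = y \<longrightarrow> (x - p) * y = 0 \<longrightarrow> y = 0)"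
proof -
  have pe: "projection e" using e by (rule abelian_projection_projection)
  have z: "central_projection z" and sum: "(\<Sum>i<n. v i * star (v i)) = z"
    using frame unfolding matrix_frame_def by auto
  have q: "projection (z * e)" by (rule projection_central_mult[OF z pe])
  note orth = matrix_frame_orthonormal[OF frame]
  define F where "F k = (\<Sum>i<k. v i * star (v i))" for k
  have "\<exists>p. projection p \<and> F k * p = p \<and> (\<forall>y. F k * y = y \<longrightarrow> F k * ((x - p) * y) = 0 \<longrightarrow> y = 0)"
    if "k \<le> n" for k
    using that
  proof (induction k)
    case 0
    show ?case by (intro exI[of _ 0]) (auto simp: F_def projection_def)
  next
    case (Suc k)
    then obtain p where p: "projection p" "F k * p = p"
      and inj: "\<And>y. F k * y = y \<Longrightarrow> F k * ((x - p) * y) = 0 \<Longrightarrow> y = 0" by auto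
    have k: "k \<in> {..<n}" using Suc.prems by simp
    have orth_k: "star (v i) * v j = (if i = j then z * e else 0)" if "i \<in> {..<k}" "j \<in> {..<k}" for i j
      using orth[of i j] that Suc.prems by simp
    have F: "projection (F k)"
      unfolding F_def by (rule orthonormal_sum_projection(1)[OF q orth_k]) auto
    have "projection (\<Sum>i\<in>{k}. v i * star (v i))"
      by (rule orthonormal_sum_projection(1)[OF q]) (use orth k in auto)
    then have vk: "projection (v k * star (v k))" by simp
    have vq: "v k * (z * e) = v k" by (rule orthonormal_right_mult[OF q orth k])
    have "v k * e = v k * (z * e) * e" unfolding vq ..
    also have "\<dots> = v k * (z * e)" by (simp only: mult.assoc projection_idem[OF pe])
    finally have ve: "v k * e = v k" unfolding vq .
    have "v i * star (v i) * v k = 0" if "i < k" for i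
    proof -
      have "star (v i) * v k = 0" using orth[of i k] that k by simp
      then show ?thesis by (simp add: mult.assoc)
    qed
    then have Fv: "F k * v k = 0" unfolding F_def sum_distrib_right by (intro sum.neutral) auto
    have vv: "v k * star (v k) * v k = v k" using orth[OF k k] vq by (simp add: mult.assoc)
    show ?case
      using injective_compression_extend[OF baer faithful e F vk ve Fv vv p inj] unfolding F_def by simp
  qed
  from this[OF order_refl] obtain p where p: "projection p" "z * p = p"
    and inj: "\<And>y. z * y = y \<Longrightarrow> z * ((x - p) * y) = 0 \<Longrightarrow> y = 0"
    unfolding F_def sum by blast
  have "y = 0" if "z * y = y" "(x - p) * y = 0" for y by (rule inj) (use that in auto)
  then show ?thesis using p by blast
qed

text \<open>Suppose that \<open>z g \<noteq> 0\<close>.  Gram-Schmidt orthogonalization of the elements \<open>b v i\<close> produces, over a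
  smaller central projection \<open>y\<close>, as many orthogonal copies of \<open>y e\<close> as the frame has.  At each step
  injectivity of \<open>b\<close> keeps the new element from vanishing.  All copies have range in that of \<open>b\<close>, so
  they are annihilated by \<open>g\<close>; but together they form an isometry of \<open>y A\<close>, whose range is \<open>y\<close> by
  finiteness.\<close>

lemma matrix_frame_injective_left:
  fixes b e g z :: "'a::cstar_algebra"
  assumes baer: "baer_star_ring TYPE('a)" and finite: "star_finite TYPE('a)"
    and faithful: "faithful_projection e" and e: "abelian_projection e"
    and frame: "matrix_frame e z n v" and inj: "\<And>y. b * y = 0 \<Longrightarrow> y = 0" and gb: "g * b = 0"
  shows "z * g = 0"
proof (rule ccontr)
  assume zg: "z * g \<noteq> 0"
  have pe: "projection e" using e by (rule abelian_projection_projection)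
  have z: "central_projection z" and sum: "(\<Sum>i<n. v i * star (v i)) = z"
    using frame unfolding matrix_frame_def by auto
  have q: "projection (z * e)" by (rule projection_central_mult[OF z pe])
  note orth = matrix_frame_orthonormal[OF frame]
  have vq: "v i * (z * e) = v i" if "i < n" for i
    by (rule orthonormal_right_mult[where I = "{..<n}", OF q orth]) (use that in auto)
  have ve: "v i * e = v i" if "i < n" for i
  proof -
    have "v i * e = v i * (z * e) * e" unfolding vq[OF that] ..
    also have "\<dots> = v i * (z * e)" by (simp only: mult.assoc projection_idem[OF pe])
    finally show ?thesis unfolding vq[OF that] .
  qed
  obtain c :: 'a where c: "central_projection c" "\<And>y. c * y = 0 \<longleftrightarrow> (\<forall>a. g * a * y = 0)" "c * g = g"
    using baer_central_cover[OF baer, of g] by blast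
  define w where "w = c * z"
  have w: "central_projection w" unfolding w_def by (rule central_projection_mult[OF c(1) z])
  have w_nonzero: "w \<noteq> 0"
  proof
    assume "w = 0"
    then have "c * z * g = 0" unfolding w_def by simp
    then have "z * c * g = 0" using central_projection_commute[OF c(1), of z] by simp
    then show False using zg by (simp add: mult.assoc c(3))
  qed
  have "\<exists>y u t. central_projection y \<and> y \<noteq> 0 \<and> w * y = y \<and>
      (\<forall>i<k. \<forall>j<k. star (u i) * u j = (if i = j then y * e else 0)) \<and>
      (\<forall>i<k. u i = b * t i \<and> (\<forall>j. k \<le> j \<longrightarrow> j < n \<longrightarrow> star (v j) * t i = 0))"
    if "k \<le> n" for k
    using that
  proof (induction k)
    case 0
    show ?case
      using w w_nonzero projection_idem[OF central_projection_projection[OF w]] by (intro exI[of _ w]) simp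
  next
    case (Suc k)
    then have kn: "k < n" by simp
    obtain y u t where y: "central_projection y" "y \<noteq> 0" "w * y = y"
      and u_all: "\<forall>i<k. \<forall>j<k. star (u i) * u j = (if i = j then y * e else 0)"
      and t_all: "\<forall>i<k. u i = b * t i \<and> (\<forall>j. k \<le> j \<longrightarrow> j < n \<longrightarrow> star (v j) * t i = 0)"
      using Suc.IH[OF less_imp_le[OF kn]] by (elim exE conjE)
    have u_orth: "star (u i) * u j = (if i = j then y * e else 0)" if "i < k" "j < k" for i j
      using u_all that by simp
    have ut: "u i = b * t i" if "i < k" for i using t_all that by simp
    have vt: "star (v j) * t i = 0" if "i < k" "k \<le> j" "j < n" for i j using t_all that by simp
    have yp: "projection y" using y(1) by (rule central_projection_projection)
    note yc = central_projection_commute[OF y(1)]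
    have y_comm: "s * (y * r) = y * (s * r)" for s r unfolding mult.assoc[symmetric] yc[of s] ..
    have qy: "projection (y * e)" by (rule projection_central_mult[OF y(1) pe])
    define S where "S = (\<Sum>i\<in>{..<k}. u i * star (u i))"
    have uS: "star (u i) * S = star (u i)" if "i < k" for i
      unfolding S_def by (rule orthonormal_sum_projection(3)[OF qy]) (use u_orth that in auto)
    \<comment> \<open>\<open>x\<close> is the component of \<open>b y v k\<close> orthogonal to the earlier \<open>u i\<close>.  It equals \<open>b T\<close>, and \<open>T\<close> is
      nonzero since its component along \<open>v k\<close> is \<open>y e\<close>.\<close>
    define r where "r = b * (y * v k)"
    define T where "T = y * v k - (\<Sum>i<k. t i * (star (u i) * r))"
    define x where "x = r - S * r"
    have "b * (\<Sum>i<k. t i * (star (u i) * r)) = S * r"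
      unfolding S_def sum_distrib_left sum_distrib_right
      by (rule sum.cong) (simp_all add: ut mult.assoc)
    then have xT: "x = b * T" unfolding x_def T_def by (simp add: right_diff_distrib r_def)
    have vT: "star (v j) * T = star (v j) * (y * v k)" if "k \<le> j" "j < n" for j
    proof -
      have "star (v j) * (\<Sum>i<k. t i * (star (u i) * r)) = 0"
        unfolding sum_distrib_left mult.assoc[symmetric]
        by (rule sum.neutral) (use vt that in auto)
      then show ?thesis unfolding T_def by (simp add: right_diff_distrib)
    qed
    have zy: "z * y = y"
    proof -
      have "z * w = w" unfolding w_def central_projection_commute[OF z, of c]
        by (rule projection_idem_left[OF central_projection_projection[OF z]])
      then have "z * (w * y) = w * y" by (simp flip: mult.assoc)
      then show ?thesis unfolding y(3) .
    qed
    have "star (v k) * T = y * (star (v k) * v k)" using vT[of k] kn by (simp add: y_comm)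
    also have "\<dots> = y * z * e" using orth[of k k] kn by (simp add: mult.assoc)
    also have "y * z = y" using trans[OF yc[of z, symmetric] zy] .
    finally have "star (v k) * T \<noteq> 0" using faithful_central_mult_eq_zero[OF faithful y(1)] y(2) by auto
    then have "T \<noteq> 0" by auto
    then have x_nonzero: "x \<noteq> 0" unfolding xT using inj by blast
    have re: "r * e = r" unfolding r_def by (simp only: mult.assoc ve[OF kn])
    have xe: "x * e = x" unfolding x_def by (simp only: left_diff_distrib mult.assoc re)
    have r_y: "r = y * (b * v k)" unfolding r_def by (rule y_comm)
    have yr: "y * r = r" unfolding r_y by (rule projection_idem_left[OF yp])
    have yx: "y * x = x" unfolding x_def right_diff_distrib y_comm[of S, symmetric] yr ..
    have ux: "star (u i) * x = 0" if "i < k" for i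
      unfolding x_def right_diff_distrib mult.assoc[symmetric] uS[OF that] by simp
    obtain s y' where y': "central_projection y'" "y' \<noteq> 0" "y * y' = y'"
      and "s * e = s" and xs: "star (x * s) * (x * s) = y' * e"
      by (rule abelian_local_copy[OF baer e xe x_nonzero y(1) yx])
    have y'p: "projection y'" using y'(1) by (rule central_projection_projection)
    have y'_comm: "a * (y' * d) = y' * (a * d)" for a d
      unfolding mult.assoc[symmetric] central_projection_commute[OF y'(1), of a] ..
    define u' where "u' i = (if i < k then y' * u i else x * s)" for i
    define t' where "t' i = (if i < k then y' * t i else T * s)" for i
    have y'y: "y' * y = y'" using y'(3) yc[of y'] by simp
    have u_star: "star (y' * u i) = y' * star (u i)" for i
      by (simp add: star_mult projection_star[OF y'p] central_projection_commute[OF y'(1)])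
    have 1: "star (y' * u i) * (y' * u j) = (if i = j then y' * e else 0)" if "i < k" "j < k" for i j
    proof -
      have "star (y' * u i) * (y' * u j) = y' * (star (u i) * u j)"
        unfolding u_star by (simp only: mult.assoc y'_comm[of "star (u i)"] projection_idem_left[OF y'p])
      also have "\<dots> = (if i = j then y' * y * e else 0)" using u_orth[OF that] by (simp add: mult.assoc)
      finally show ?thesis unfolding y'y .
    qed
    have 2: "star (y' * u i) * (x * s) = 0" if "i < k" for i
    proof -
      have "star (y' * u i) * (x * s) = y' * ((star (u i) * x) * s)" unfolding u_star by (simp only: mult.assoc)
      then show ?thesis unfolding ux[OF that] by simp
    qed
    have 3: "star (x * s) * (y' * u i) = 0" if "i < k" for i
      using arg_cong[OF 2[OF that], of star] by (simp only: star_mult[of "star _"] star_star star_zero)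
    have u'_orth: "star (u' i) * u' j = (if i = j then y' * e else 0)" if "i < Suc k" "j < Suc k" for i j
    proof -
      consider "i < k" "j < k" | "i < k" "j = k" | "i = k" "j < k" | "i = k" "j = k"
        using \<open>i < Suc k\<close> \<open>j < Suc k\<close> by linarith
      then show ?thesis unfolding u'_def by cases (simp_all add: 1 2 3 xs)
    qed
    have u't': "u' i = b * t' i" for i
      unfolding u'_def t'_def using ut[of i] by (simp add: xT y'_comm mult.assoc)
    have vt': "star (v j) * t' i = 0" if "i < Suc k" "Suc k \<le> j" "j < n" for i j
    proof (cases "i < k")
      case True
      then show ?thesis unfolding t'_def using vt[of i j] that by (simp add: y'_comm)
    next
      case False
      have "star (v j) * T = y * (star (v j) * v k)" using vT[of j] that by (simp add: y_comm)
      also have "\<dots> = 0" using orth[of j k] that kn by simp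
      finally have "star (v j) * T * s = 0" by simp
      then show ?thesis unfolding t'_def using False by (simp add: mult.assoc)
    qed
    have wy': "w * y' = y'"
    proof -
      have "w * (y * y') = y * y'" unfolding mult.assoc[symmetric] y(3) ..
      then show ?thesis unfolding y'(3) .
    qed
    show ?case
      by (rule exI[of _ y'], rule exI[of _ u'], rule exI[of _ t'], intro conjI allI impI)
        (rule y'(1) y'(2) wy' u't' u'_orth vt' | assumption)+
  qed
  from this[OF order_refl] obtain y u t where y: "central_projection y" "y \<noteq> 0" "w * y = y"
    and u_all: "\<forall>i<n. \<forall>j<n. star (u i) * u j = (if i = j then y * e else 0)"
    and t_all: "\<forall>i<n. u i = b * t i \<and> (\<forall>j. n \<le> j \<longrightarrow> j < n \<longrightarrow> star (v j) * t i = 0)"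
    by (elim exE conjE)
  have u_orth: "star (u i) * u j = (if i = j then y * e else 0)" if "i < n" "j < n" for i j
    using u_all that by simp
  have ut: "u i = b * t i" if "i < n" for i using t_all that by simp
  have yp: "projection y" using y(1) by (rule central_projection_projection)
  note yc = central_projection_commute[OF y(1)]
  define U where "U = (\<Sum>i<n. u i * star (v i))"
  have U_star: "star U = (\<Sum>i<n. v i * star (u i))" unfolding U_def by (simp add: star_sum star_mult star_star)
  have uU: "star (u i) * U = y * star (v i)" if "i < n" for i
  proof -
    have "star (u i) * U = (\<Sum>j<n. if j = i then y * e * star (v j) else 0)"
      unfolding U_def sum_distrib_left mult.assoc[symmetric]
      by (rule sum.cong) (use u_orth[OF that] in auto)
    also have "\<dots> = y * (e * star (v i))" using that by (simp add: mult.assoc)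
    also have "e * star (v i) = star (v i * e)" by (simp add: star_mult projection_star[OF pe])
    finally show ?thesis unfolding ve[OF that] .
  qed
  have "star U * U = (\<Sum>i<n. y * (v i * star (v i)))"
    unfolding U_star sum_distrib_right
  proof (rule sum.cong)
    fix i assume "i \<in> {..<n}"
    then have "v i * star (u i) * U = v i * (y * star (v i))" using uU by (simp add: mult.assoc)
    also have "\<dots> = y * (v i * star (v i))" unfolding mult.assoc[symmetric] yc[of "v i"] ..
    finally show "v i * star (u i) * U = y * (v i * star (v i))" .
  qed simp
  also have "\<dots> = y * z" unfolding sum_distrib_left[symmetric] sum ..
  also have "\<dots> = y"
  proof -
    have "w * z = w" unfolding w_def mult.assoc using projection_idem[OF central_projection_projection[OF z]] by simp
    then have "w * z * y = y" using y(3) by simp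
    moreover have "w * z * y = w * y * z" unfolding mult.assoc central_projection_commute[OF z, of y] ..
    ultimately show ?thesis unfolding y(3) by simp
  qed
  finally have UU: "star U * U = y" .
  have gU: "g * U = 0"
    unfolding U_def sum_distrib_left
  proof (rule sum.neutral, rule ballI)
    fix i assume "i \<in> {..<n}"
    then have "g * (u i * star (v i)) = g * b * (t i * star (v i))" using ut by (simp add: mult.assoc)
    then show "g * (u i * star (v i)) = 0" unfolding gb by simp
  qed
  have Uy: "U * y = U" by (rule partial_isometry_initial[OF yp]) (simp add: UU projection_idem[OF yp])
  then have yU: "y * U = U" using yc[of U] by simp
  have Uy': "star U * y = star U" using arg_cong[OF yU, of star] by (simp only: star_mult projection_star[OF yp])
  have yU': "y * star U = star U" using arg_cong[OF Uy, of star] by (simp only: star_mult projection_star[OF yp])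
  define X where "X = U + (1 - y)"
  have X_star: "star X = star U + (1 - y)" unfolding X_def by (simp add: star_add star_diff projection_star[OF yp])
  have "star X * X = star U * U + (1 - y)"
    unfolding X_star unfolding X_def
    by (simp add: distrib_left distrib_right left_diff_distrib right_diff_distrib Uy' yU projection_idem[OF yp])
  then have "star X * X = 1" unfolding UU by simp
  then have XX: "X * star X = 1" using finite unfolding star_finite_def by blast
  have "X * star X = U * star U + (1 - y)"
    unfolding X_star unfolding X_def
    by (simp add: distrib_left distrib_right left_diff_distrib right_diff_distrib Uy yU' projection_idem[OF yp])
  then have "U * star U = y" unfolding XX by (simp add: algebra_simps)
  then have "g * y = g * U * star U" by (simp add: mult.assoc)
  then have gy: "g * y = 0" unfolding gU by simp
  have "g * a * y = 0" for a
  proof -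
    have "g * a * y = g * y * a" unfolding mult.assoc yc[of a] ..
    then show ?thesis unfolding gy by simp
  qed
  then have cy: "c * y = 0" using c(2) by blast
  have "w * y = z * (c * y)" unfolding w_def central_projection_commute[OF z, of c] mult.assoc ..
  then show False using y(2,3) cy by simp
qed

section \<open>Almost star-clean algebras of type \<open>I\<^sub>f\<close>\<close>

text \<open>The projection \<open>g\<close> that generates the left annihilator of \<open>b\<close> vanishes over every framed central
  projection, and the central cover of a nonzero \<open>g\<close> dominates one of these.\<close>

lemma injective_imp_regular:
  fixes b e :: "'a::cstar_algebra"
  assumes baer: "baer_star_ring TYPE('a)" and finite: "star_finite TYPE('a)"
    and faithful: "faithful_projection e" and e: "abelian_projection e"
    and inj: "\<And>y. b * y = 0 \<Longrightarrow> y = 0"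
  shows "regular_element b"
proof -
  have "y = 0" if yb: "y * b = 0" for y
  proof -
    obtain h :: 'a where h: "projection h" "\<And>y. h * y = 0 \<longleftrightarrow> (\<forall>s\<in>{star b}. s * y = 0)"
      using baer_support[OF baer, of "{star b}"] by blast
    have "star b * h = star b" by (rule support_absorb[OF h]) simp
    from arg_cong[OF this, of star] have hb: "h * b = b"
      by (simp only: star_mult star_star projection_star[OF h(1)])
    define g where "g = 1 - h"
    have gb: "g * b = 0" unfolding g_def by (simp add: left_diff_distrib hb)
    have "g = 0"
    proof (rule ccontr)
      assume "g \<noteq> 0"
      obtain c :: 'a where c: "central_projection c" "\<And>y. c * y = 0 \<longleftrightarrow> (\<forall>a. g * a * y = 0)" "c * g = g"
        using baer_central_cover[OF baer, of g] by blast
      have "c \<noteq> 0" using \<open>g \<noteq> 0\<close> c(3) by auto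
      then obtain z n v where z: "z \<noteq> 0" "c * z = z" "matrix_frame e z n v"
        using matrix_frame_exists[OF baer finite faithful e c(1)] by blast
      have zc: "central_projection z" using z(3) unfolding matrix_frame_def by blast
      have zg: "z * g = 0" by (rule matrix_frame_injective_left[OF baer finite faithful e z(3) inj gb])
      have "g * a * z = 0" for a
      proof -
        have "g * a * z = z * g * a"
          unfolding central_projection_commute[OF zc, of "g * a"] by (simp only: mult.assoc)
        then show ?thesis unfolding zg by simp
      qed
      then have "c * z = 0" using c(2) by blast
      then show False using z(1,2) by simp
    qed
    then have "h = 1" unfolding g_def by simp
    have "star b * star y = 0" using arg_cong[OF yb, of star] by (simp only: star_mult star_zero)
    then have "h * star y = 0" using h(2) by simp
    then have "star y = 0" unfolding \<open>h = 1\<close> by simp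
    from arg_cong[OF this, of star] show "y = 0" by (simp add: star_star)
  qed
  then show ?thesis using inj unfolding regular_element_def by blast
qed

text \<open>The projections found over the members of an orthogonal family of framed central projections with
  supremum \<open>1\<close> have a supremum \<open>p\<close>, and over each member \<open>p\<close> agrees with the projection found there.\<close>

theorem aw_star_type_I_f_almost_star_clean:
  assumes aw: "aw_star_algebra TYPE('a::cstar_algebra)" and type: "type_I_f TYPE('a)"
  shows "almost_star_clean TYPE('a)"
  unfolding almost_star_clean_def
proof
  fix x :: 'a
  have baer: "baer_star_ring TYPE('a)" using aw unfolding aw_star_algebra_def .
  have finite: "star_finite TYPE('a)" using type unfolding type_I_f_def by blast
  obtain e :: 'a where faithful: "faithful_projection e" and e: "abelian_projection e"
    using type unfolding type_I_f_def type_I_def by blast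
  have one: "central_projection (1::'a)" unfolding central_projection_def projection_def by simp
  define P where "P z \<longleftrightarrow> (\<exists>p. projection p \<and> z * p = p \<and> (\<forall>y. z * y = y \<longrightarrow> (x - p) * y = 0 \<longrightarrow> y = 0))"
    for z
  have dense: "\<exists>z. central_projection z \<and> z \<noteq> 0 \<and> w * z = z \<and> P z"
    if w: "central_projection w" "w \<noteq> 0" for w
  proof -
    obtain z n v where z: "z \<noteq> 0" "w * z = z" "matrix_frame e z n v"
      using matrix_frame_exists[OF baer finite faithful e w] by blast
    have "P z" unfolding P_def by (rule matrix_frame_injective_perturbation[OF baer faithful e z(3)])
    moreover have "central_projection z" using z(3) unfolding matrix_frame_def by blast
    ultimately show ?thesis using z(1,2) by (intro exI[of _ z] conjI)
  qed
  obtain Z where Z: "\<And>z. z \<in> Z \<Longrightarrow> central_projection z \<and> 1 * z = z \<and> P z"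
    and Z_orth: "\<And>z z'. z \<in> Z \<Longrightarrow> z' \<in> Z \<Longrightarrow> z \<noteq> z' \<Longrightarrow> z * z' = 0"
    and Z_sup: "\<And>y. 1 * y = 0 \<longleftrightarrow> (\<forall>z\<in>Z. z * y = 0)"
    using baer_exhaust_central[OF baer one, of P, OF dense] by blast
  define p where "p z = (SOME p. projection p \<and> z * p = p \<and> (\<forall>y. z * y = y \<longrightarrow> (x - p) * y = 0 \<longrightarrow> y = 0))"
    for z
  have p: "projection (p z)" "z * p z = p z" "\<And>y. z * y = y \<Longrightarrow> (x - p z) * y = 0 \<Longrightarrow> y = 0"
    if "z \<in> Z" for z
  proof -
    have "\<exists>p. projection p \<and> z * p = p \<and> (\<forall>y. z * y = y \<longrightarrow> (x - p) * y = 0 \<longrightarrow> y = 0)"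
      using Z[OF that] unfolding P_def by blast
    note * = someI_ex[OF this, folded p_def]
    show "projection (p z)" by (rule conjunct1[OF *])
    show "z * p z = p z" by (rule conjunct1[OF conjunct2[OF *]])
    show "y = 0" if "z * y = y" "(x - p z) * y = 0" for y
      by (rule conjunct2[OF conjunct2[OF *], rule_format, OF that])
  qed
  have Zc: "central_projection z" if "z \<in> Z" for z using Z[OF that] by blast
  have Zp: "projection z" if "z \<in> Z" for z using Zc[OF that] by (rule central_projection_projection)
  obtain q :: 'a where q: "projection q" "\<And>y. q * y = 0 \<longleftrightarrow> (\<forall>s\<in>p ` Z. s * y = 0)"
    using baer_support[OF baer, of "p ` Z"] by blast
  have zq: "z * q = p z" if z: "z \<in> Z" for z
  proof -
    have "p z * q = p z" by (rule support_absorb[OF q]) (use z in blast)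
    from arg_cong[OF this, of star] have qp: "q * p z = p z"
      by (simp only: star_mult projection_star[OF q(1)] projection_star[OF p(1)[OF z]])
    have "p z' * (z * (1 - p z)) = 0" if z': "z' \<in> Z" for z'
    proof (cases "z' = z")
      case True
      have "p z * (z * (1 - p z)) = z * (p z * (1 - p z))"
        unfolding mult.assoc[symmetric] central_projection_commute[OF Zc[OF z], of "p z"] ..
      then show ?thesis unfolding True by (simp add: right_diff_distrib projection_idem[OF p(1)[OF z]])
    next
      case False
      have "p z' * z = z' * p z' * z" unfolding p(2)[OF z'] ..
      also have "\<dots> = z' * z * p z'"
        unfolding mult.assoc central_projection_commute[OF Zc[OF z], of "p z'"] ..
      finally have "p z' * z = 0" using Z_orth[OF z' z False] by simp
      then have "p z' * z * (1 - p z) = 0" by simp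
      then show ?thesis by (simp only: mult.assoc)
    qed
    then have "q * (z * (1 - p z)) = 0" using q(2) by blast
    then have "q * z = q * (z * p z)" by (simp add: right_diff_distrib)
    then show ?thesis unfolding p(2)[OF z] qp central_projection_commute[OF Zc[OF z], of q] .
  qed
  have "y = 0" if y: "(x - q) * y = 0" for y
  proof -
    have "z * y = 0" if z: "z \<in> Z" for z
    proof (rule p(3)[OF z])
      show "z * (z * y) = z * y" by (rule projection_idem_left[OF Zp[OF z]])
      have "z * p z = z * q" unfolding zq[OF z] by (rule p(2)[OF z])
      then have "(x - p z) * z = (x - q) * z"
        using central_projection_commute[OF Zc[OF z], of "p z"] central_projection_commute[OF Zc[OF z], of q]
        by (simp add: left_diff_distrib)
      also have "\<dots> = z * (x - q)" by (rule central_projection_commute[OF Zc[OF z]])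
      finally have "(x - p z) * z * y = z * (x - q) * y" by simp
      then show "(x - p z) * (z * y) = 0" by (simp only: mult.assoc y) simp
    qed
    then show "y = 0" using Z_sup[of y] by simp
  qed
  then have "regular_element (x - q)" by (rule injective_imp_regular[OF baer finite faithful e])
  moreover have "x = (x - q) + q" by simp
  ultimately show "\<exists>u p. regular_element u \<and> projection p \<and> x = u + p" using q(1) by (intro exI conjI)
qed

lemma von_neumann_regular_imp_unit:
  assumes "von_neumann_regular TYPE('a::star_ring)" and u: "regular_element (u::'a)"
  shows "unit_element u"
proof -
  obtain v where v: "u * v * u = u" using assms(1) unfolding von_neumann_regular_def by blast
  have "u * (v * u - 1) = 0" using v by (simp add: right_diff_distrib mult.assoc)
  then have "v * u - 1 = 0" using u unfolding regular_element_def by blast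
  moreover have "(u * v - 1) * u = 0" using v by (simp add: left_diff_distrib)
  then have "u * v - 1 = 0" using u unfolding regular_element_def by blast
  ultimately show ?thesis unfolding unit_element_def by (intro exI[of _ v]) simp
qed

lemma von_neumann_regular_imp_star_clean:
  assumes "von_neumann_regular TYPE('a::star_ring)" "almost_star_clean TYPE('a)"
  shows "star_clean TYPE('a)"
  unfolding star_clean_def
proof
  fix x :: 'a
  obtain u p where "regular_element u" "projection p" "x = u + p"
    using assms(2) unfolding almost_star_clean_def by blast
  moreover have "unit_element u"
    by (rule von_neumann_regular_imp_unit[OF assms(1) \<open>regular_element u\<close>])
  ultimately show "\<exists>u p. unit_element u \<and> projection p \<and> x = u + p" by (intro exI conjI)
qed

section \<open>Von Neumann algebras are Baer star-rings\<close>

lemma cinner_scaleC_right: "cinner x (scaleC c y) = c * cinner x (y::'h::complex_hilbert_space)"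
  by (metis cinner_commute cinner_scaleC_left complex_cnj_cnj complex_cnj_mult)

lemma cinner_add_right: "cinner x (y + z) = cinner x y + cinner x (z::'h::complex_hilbert_space)"
  by (metis cinner_add_left cinner_commute complex_cnj_add)

lemma cinner_diff_left: "cinner (x - y) z = cinner x z - cinner y (z::'h::complex_hilbert_space)"
  using cinner_add_left[of "x - y" y z] by simp

lemma cinner_diff_right: "cinner x (y - z) = cinner x y - cinner x (z::'h::complex_hilbert_space)"
  using cinner_add_right[of x "y - z" z] by simp

lemma cinner_zero_left [simp]: "cinner 0 (x::'h::complex_hilbert_space) = 0"
  using cinner_diff_left[of 0 0 x] by simp

lemma cinner_zero_right [simp]: "cinner (x::'h::complex_hilbert_space) 0 = 0"
  using cinner_diff_right[of x 0 0] by simp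

lemma cinner_self_eq_zero: "cinner x x = 0 \<longleftrightarrow> (x::'h::complex_hilbert_space) = 0"
  by (simp add: cinner_self)

lemma norm_diff_square:
  "(norm (x - y))\<^sup>2 = (norm x)\<^sup>2 - 2 * Re (cinner x y) + (norm (y::'h::complex_hilbert_space))\<^sup>2"
proof -
  have "complex_of_real ((norm (x - y))\<^sup>2) = cinner x x - (cinner x y + cnj (cinner x y)) + cinner y y"
    unfolding cinner_self[symmetric] cinner_commute[of y x, symmetric]
    by (simp add: cinner_diff_left cinner_diff_right)
  also have "\<dots> = complex_of_real ((norm x)\<^sup>2 - 2 * Re (cinner x y) + (norm y)\<^sup>2)"
    by (simp add: cinner_self complex_add_cnj)
  finally show ?thesis by (simp only: of_real_eq_iff)
qed

text \<open>If \<open>t\<close> is the inner product of \<open>n\<close> and \<open>v\<close>, the choice \<open>c = t / \<parallel>n\<parallel>\<^sup>2\<close> lowers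
  \<open>\<parallel>v\<parallel>\<^sup>2\<close> by \<open>\<bar>t\<bar>\<^sup>2 / \<parallel>n\<parallel>\<^sup>2\<close>.\<close>

lemma orthogonal_iff_norm_minimal:
  fixes n v :: "'h::complex_hilbert_space"
  shows "cinner n v = 0 \<longleftrightarrow> (\<forall>c. norm v \<le> norm (v - scaleC c n))"
proof
  assume "cinner n v = 0"
  then have "cinner v (scaleC c n) = 0" for c
    using cinner_commute[of v n] by (simp add: cinner_scaleC_right)
  then have "(norm v)\<^sup>2 \<le> (norm (v - scaleC c n))\<^sup>2" for c
    unfolding norm_diff_square by simp
  then show "\<forall>c. norm v \<le> norm (v - scaleC c n)" by (simp add: power2_le_iff_abs_le)
next
  assume min: "\<forall>c. norm v \<le> norm (v - scaleC c n)"
  show "cinner n v = 0"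
  proof (cases "n = 0")
    case False
    define t where "t = cinner n v"
    define c where "c = t / complex_of_real ((norm n)\<^sup>2)"
    have tt: "t * cnj t = complex_of_real ((cmod t)\<^sup>2)" using complex_norm_square[of t] by simp
    have "cinner v (scaleC c n) = t * cnj t / complex_of_real ((norm n)\<^sup>2)"
      unfolding c_def t_def cinner_commute[of n v] by (simp add: cinner_scaleC_right)
    then have re: "Re (cinner v (scaleC c n)) = (cmod t)\<^sup>2 / (norm n)\<^sup>2"
      unfolding tt by (simp flip: of_real_power of_real_divide)
    have "cmod c = cmod t / (norm n)\<^sup>2" unfolding c_def by (simp add: norm_divide norm_power)
    then have nc: "(norm (scaleC c n))\<^sup>2 = (cmod t)\<^sup>2 / (norm n)\<^sup>2"
      using False by (simp add: norm_scaleC power_mult_distrib power_divide power2_eq_square)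
    have "(norm v)\<^sup>2 \<le> (norm (v - scaleC c n))\<^sup>2" using min by simp
    then have "(cmod t)\<^sup>2 / (norm n)\<^sup>2 \<le> 0" unfolding norm_diff_square re nc by simp
    then have "(cmod t)\<^sup>2 \<le> 0" using False by (simp add: divide_le_0_iff)
    then show ?thesis unfolding t_def by simp
  qed simp
qed

definition closed_complex_subspace :: "'h::complex_hilbert_space set \<Rightarrow> bool" where
  "closed_complex_subspace N \<longleftrightarrow> closed N \<and> 0 \<in> N \<and> (\<forall>x\<in>N. \<forall>y\<in>N. x + y \<in> N) \<and>
     (\<forall>c. \<forall>x\<in>N. scaleC c x \<in> N)"

lemma closed_complex_subspace_diff:
  assumes "closed_complex_subspace N" "x \<in> N" "y \<in> N"
  shows "x - y \<in> N"
proof -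
  have "scaleC (-1) y \<in> N" using assms unfolding closed_complex_subspace_def by blast
  then have "x + - y \<in> N" unfolding scaleC_minus_one using assms unfolding closed_complex_subspace_def by blast
  then show ?thesis by simp
qed

lemma continuous_scaleC: "continuous_on UNIV (scaleC c :: 'h::complex_hilbert_space \<Rightarrow> 'h)"
proof (rule linear_continuous_on, rule bounded_linear_intro)
  show "scaleC c (r *\<^sub>R x) = r *\<^sub>R scaleC c x" for r and x :: 'h
    by (simp add: scaleC_scaleC mult.commute flip: scaleC_of_real)
  show "norm (scaleC c x) \<le> norm x * cmod c" for x :: 'h by (simp add: norm_scaleC)
qed (simp add: scaleC_add_right)

text \<open>The characterization of orthogonality by norms makes the subspace an intersection of closed
  sets.\<close>

lemma closed_complex_subspace_orthogonal:
  fixes v :: "'h::complex_hilbert_space"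
  shows "closed_complex_subspace {n. cinner n v = 0}"
proof -
  have "closed {n. norm v \<le> norm (v - scaleC c n)}" for c
    by (intro closed_Collect_le continuous_intros continuous_scaleC)
  then have "closed (\<Inter>c. {n. norm v \<le> norm (v - scaleC c n)})" by blast
  moreover have "(\<Inter>c. {n. norm v \<le> norm (v - scaleC c n)}) = {n. cinner n v = 0}"
    by (auto simp: orthogonal_iff_norm_minimal)
  ultimately show ?thesis
    unfolding closed_complex_subspace_def by (simp add: cinner_add_left cinner_scaleC_left)
qed

text \<open>By the parallelogram law a sequence that minimizes the distance to \<open>v\<close> is a Cauchy sequence,
  and its limit \<open>m\<close> realizes that distance.\<close>

lemma closed_complex_subspace_projection:
  fixes v :: "'h::complex_hilbert_space"
  assumes N: "closed_complex_subspace N"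
  shows "\<exists>m\<in>N. \<forall>n\<in>N. cinner n (v - m) = 0"
proof -
  define d where "d = (INF n\<in>N. (norm (v - n))\<^sup>2)"
  have zero: "0 \<in> N" and add: "\<And>x y. x \<in> N \<Longrightarrow> y \<in> N \<Longrightarrow> x + y \<in> N"
    and scale: "\<And>c x. x \<in> N \<Longrightarrow> scaleC c x \<in> N" and closed: "closed N"
    using N unfolding closed_complex_subspace_def by blast+
  have bdd: "bdd_below ((\<lambda>n. (norm (v - n))\<^sup>2) ` N)" by (rule bdd_belowI[of _ 0]) auto
  have d_le: "d \<le> (norm (v - n))\<^sup>2" if "n \<in> N" for n
    unfolding d_def by (rule cINF_lower[OF bdd that])
  have "\<exists>n\<in>N. (norm (v - n))\<^sup>2 < d + inverse (real (Suc k))" for k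
  proof -
    have "d < d + inverse (real (Suc k))" by simp
    then show ?thesis unfolding d_def using cINF_less_iff[OF _ bdd] zero by blast
  qed
  then obtain s where s: "\<And>k. s k \<in> N" "\<And>k. (norm (v - s k))\<^sup>2 < d + inverse (real (Suc k))" by metis
  have dist_le: "(norm (s i - s j))\<^sup>2 \<le> 2 * inverse (real (Suc i)) + 2 * inverse (real (Suc j))" for i j
  proof -
    define x y where "x = v - s i" and "y = v - s j"
    have "(norm (x - y))\<^sup>2 + (norm (x - - y))\<^sup>2 = 2 * (norm x)\<^sup>2 + 2 * (norm y)\<^sup>2"
      unfolding norm_diff_square using cinner_diff_right[of x 0 y] by simp
    moreover have "4 * d \<le> (norm (x - - y))\<^sup>2"
    proof -
      define m where "m = (1/2) *\<^sub>R (s i + s j)"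
      have "m \<in> N"
        unfolding m_def scaleC_of_real[symmetric] by (intro scale add s)
      have "x - - y = 2 *\<^sub>R (v - m)"
        unfolding x_def y_def m_def by (simp add: scaleR_diff_right scaleR_2)
      then have "(norm (x - - y))\<^sup>2 = 4 * (norm (v - m))\<^sup>2" by (simp add: power_mult_distrib)
      then show ?thesis using d_le[OF \<open>m \<in> N\<close>] by simp
    qed
    ultimately have "(norm (x - y))\<^sup>2 \<le> 2 * inverse (real (Suc i)) + 2 * inverse (real (Suc j))"
      using s(2)[of i] s(2)[of j] unfolding x_def y_def by linarith
    moreover have "norm (x - y) = norm (s i - s j)"
      unfolding x_def y_def by (simp add: norm_minus_commute)
    ultimately show ?thesis by simp
  qed
  have "Cauchy s"
  proof (rule CauchyI)
    fix \<epsilon> :: real assume "\<epsilon> > 0"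
    then obtain k where k: "inverse (real (Suc k)) < \<epsilon>\<^sup>2 / 4" using reals_Archimedean[of "\<epsilon>\<^sup>2 / 4"] by auto
    have "norm (s i - s j) < \<epsilon>" if "i \<ge> k" "j \<ge> k" for i j
    proof -
      have "inverse (real (Suc i)) \<le> inverse (real (Suc k))" "inverse (real (Suc j)) \<le> inverse (real (Suc k))"
        using that by (auto intro!: le_imp_inverse_le)
      then have "(norm (s i - s j))\<^sup>2 < \<epsilon>\<^sup>2" using dist_le[of i j] k by linarith
      then show ?thesis using \<open>\<epsilon> > 0\<close> by (simp add: power2_less_imp_less)
    qed
    then show "\<exists>M. \<forall>m\<ge>M. \<forall>n\<ge>M. norm (s m - s n) < \<epsilon>" by blast
  qed
  then obtain m where lim: "s \<longlonglongrightarrow> m" using Cauchy_convergent unfolding convergent_def by blast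
  have m: "m \<in> N" using closed_sequentially[OF closed s(1) lim] .
  have "(\<lambda>k. (norm (v - s k))\<^sup>2) \<longlonglongrightarrow> (norm (v - m))\<^sup>2" by (intro tendsto_intros lim)
  moreover have "(\<lambda>k. d + inverse (real (Suc k))) \<longlonglongrightarrow> d + 0"
    by (intro tendsto_add tendsto_const LIMSEQ_inverse_real_of_nat)
  ultimately have "(norm (v - m))\<^sup>2 \<le> d + 0" by (rule LIMSEQ_le) (use s(2) less_imp_le in blast)
  then have md: "(norm (v - m))\<^sup>2 \<le> d" by simp
  have "cinner n (v - m) = 0" if n: "n \<in> N" for n
    unfolding orthogonal_iff_norm_minimal
  proof
    fix c
    have "(norm (v - m))\<^sup>2 \<le> (norm (v - (m + scaleC c n)))\<^sup>2"
      using md d_le[OF add[OF m scale[OF n]]] by (rule order_trans)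
    moreover have "v - (m + scaleC c n) = v - m - scaleC c n" by simp
    ultimately show "norm (v - m) \<le> norm (v - m - scaleC c n)" by (simp add: power2_le_iff_abs_le)
  qed
  then show ?thesis using m by blast
qed

lemma closed_complex_subspace_projection_unique:
  assumes N: "closed_complex_subspace N" and m: "m \<in> N" "\<forall>n\<in>N. cinner n (v - m) = 0"
    and m': "m' \<in> N" "\<forall>n\<in>N. cinner n (v - m') = 0"
  shows "m = m'"
proof -
  have "m - m' \<in> N" by (rule closed_complex_subspace_diff[OF N m(1) m'(1)])
  then have "cinner (m - m') ((v - m') - (v - m)) = 0" unfolding cinner_diff_right[of _ "v - m'"] using m m' by simp
  then show ?thesis by (simp add: cinner_self_eq_zero)
qed

text \<open>The uniqueness in the last clause serves to compute \<open>Q\<close>, and in particular to show that it commutes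
  with the operators that leave \<open>N\<close> and its orthogonal complement invariant.\<close>

lemma orthogonal_projection_operator:
  fixes N :: "'h::complex_hilbert_space set"
  assumes N: "closed_complex_subspace N"
  obtains Q where "Q \<in> bounded_operators" "\<And>v. Q v \<in> N" "\<And>v n. n \<in> N \<Longrightarrow> cinner n (v - Q v) = 0"
    "\<And>v w. cinner (Q v) w = cinner v (Q w)" "\<And>v m. m \<in> N \<Longrightarrow> \<forall>n\<in>N. cinner n (v - m) = 0 \<Longrightarrow> Q v = m"
proof -
  have "\<exists>Q. \<forall>v. Q v \<in> N \<and> (\<forall>n\<in>N. cinner n (v - Q v) = 0)"
    by (rule choice) (use closed_complex_subspace_projection[OF N] in blast)
  then obtain Q where Q: "\<And>v. Q v \<in> N" "\<And>v n. n \<in> N \<Longrightarrow> cinner n (v - Q v) = 0" by blast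
  have unique: "Q v = m" if "m \<in> N" "\<forall>n\<in>N. cinner n (v - m) = 0" for v m
    using closed_complex_subspace_projection_unique[OF N _ _ that] Q by blast
  have add: "x + y \<in> N" if "x \<in> N" "y \<in> N" for x y using N that unfolding closed_complex_subspace_def by blast
  have scale: "scaleC c x \<in> N" if "x \<in> N" for c x using N that unfolding closed_complex_subspace_def by blast
  have Q_add: "Q (v + w) = Q v + Q w" for v w
  proof (rule unique[OF add[OF Q(1) Q(1)]], rule ballI)
    fix n assume "n \<in> N"
    then have "cinner n (v - Q v) + cinner n (w - Q w) = 0" using Q(2) by simp
    then have "cinner n ((v - Q v) + (w - Q w)) = 0" unfolding cinner_add_right .
    then show "cinner n (v + w - (Q v + Q w)) = 0" by (simp add: add_diff_add)
  qed
  have Q_scale: "Q (scaleC c v) = scaleC c (Q v)" for c v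
  proof (rule unique[OF scale[OF Q(1)]], rule ballI)
    fix n assume "n \<in> N"
    then have "cinner n (scaleC c (v - Q v)) = 0" using Q(2) by (simp add: cinner_scaleC_right)
    then show "cinner n (scaleC c v - scaleC c (Q v)) = 0" unfolding scaleC_diff_right .
  qed
  have Q_norm: "norm (Q v) \<le> norm v" for v
  proof -
    have "Re (cinner (Q v) (- (v - Q v))) = 0"
      using Q(2)[OF Q(1), of v v] cinner_diff_right[of "Q v" 0 "v - Q v"] by simp
    then have "(norm (Q v))\<^sup>2 \<le> (norm (Q v - - (v - Q v)))\<^sup>2"
      using norm_diff_square[of "Q v" "- (v - Q v)"] zero_le_power2[of "norm (- (v - Q v))"] by linarith
    moreover have "Q v - - (v - Q v) = v" by simp
    ultimately have "(norm (Q v))\<^sup>2 \<le> (norm v)\<^sup>2" by (simp only:)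
    then show ?thesis by (simp add: power2_le_iff_abs_le)
  qed
  have "bounded_linear Q"
  proof (rule bounded_linear_intro[of _ 1])
    show "Q (r *\<^sub>R v) = r *\<^sub>R Q v" for r v using Q_scale[of "complex_of_real r"] by (simp add: scaleC_of_real)
  qed (simp_all add: Q_add Q_norm)
  then have "Q \<in> bounded_operators" using Q_scale unfolding bounded_operators_def by blast
  moreover have "cinner (Q v) w = cinner v (Q w)" for v w
  proof -
    have Qc: "cinner (Q x) y = cinner (Q x) (Q y)" for x y
      using Q(2)[OF Q(1), of x y] by (simp add: cinner_diff_right)
    have "cinner v (Q w) = cnj (cinner (Q w) (Q v))" using Qc[of w v] cinner_commute[of v "Q w"] by simp
    also have "\<dots> = cinner (Q v) (Q w)" by (rule cinner_commute[symmetric])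
    finally show ?thesis using Qc[of v w] by simp
  qed
  ultimately show ?thesis using that[of Q] Q unique by blast
qed

text \<open>The right annihilator of \<open>S\<close> consists of the operators with range in the common kernel of \<open>S\<close>,
  the orthogonal complement of the closed subspace \<open>N\<close> spanned by the ranges of the adjoints.  Both
  are invariant under the commutant, so that the projection onto \<open>N\<close> lies in the double
  commutant.\<close>

lemma von_neumann_algebra_baer:
  assumes vn: "von_neumann_algebra TYPE('h::complex_hilbert_space) TYPE('a::cstar_algebra)"
  shows "baer_star_ring TYPE('a)"
  unfolding baer_star_ring_def
proof (intro allI impI)
  fix S :: "'a set"
  obtain M :: "('h \<Rightarrow> 'h) set" and \<pi> :: "'a \<Rightarrow> 'h \<Rightarrow> 'h"
    where M: "von_neumann_algebra_on M" and iso: "star_isomorphism_onto \<pi> M"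
    using vn unfolding von_neumann_algebra_def by blast
  have bij: "bij_betw \<pi> UNIV M" and \<pi>_add: "\<And>x y v. \<pi> (x + y) v = \<pi> x v + \<pi> y v"
    and \<pi>_mult: "\<And>x y v. \<pi> (x * y) v = \<pi> x (\<pi> y v)"
    and \<pi>_adj: "\<And>x v w. cinner (\<pi> x v) w = cinner v (\<pi> (star x) w)"
    using iso unfolding star_isomorphism_onto_def adjoint_operators_def by simp_all
  have \<pi>_inj: "x = y" if "\<And>v. \<pi> x v = \<pi> y v" for x y
  proof -
    have "\<pi> x = \<pi> y" using that by (rule ext)
    then show ?thesis using bij by (simp add: bij_betw_def inj_eq)
  qed
  have \<pi>_zero: "\<pi> 0 v = 0" for v using \<pi>_add[of 0 0 v] by simp
  define L where "L = {N. closed_complex_subspace N \<and> (\<forall>s\<in>S. \<forall>w. \<pi> (star s) w \<in> N)}"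
  define N where "N = \<Inter>L"
  have N: "closed_complex_subspace N"
    unfolding N_def closed_complex_subspace_def
    by (intro conjI closed_Inter) (auto simp: L_def closed_complex_subspace_def)
  have range_N: "\<pi> (star s) w \<in> N" if "s \<in> S" for s w using that unfolding N_def L_def by blast
  have kernel: "(\<forall>s\<in>S. \<pi> s v = 0) \<longleftrightarrow> (\<forall>n\<in>N. cinner n v = 0)" for v
  proof
    assume ker: "\<forall>s\<in>S. \<pi> s v = 0"
    have "cinner (\<pi> (star s) w) v = 0" if "s \<in> S" for s w
      using ker that by (simp add: \<pi>_adj star_star)
    then have "{n. cinner n v = 0} \<in> L"
      unfolding L_def using closed_complex_subspace_orthogonal[of v] by blast
    then show "\<forall>n\<in>N. cinner n v = 0" unfolding N_def by blast
  next
    assume orth: "\<forall>n\<in>N. cinner n v = 0"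
    show "\<forall>s\<in>S. \<pi> s v = 0"
    proof
      fix s assume "s \<in> S"
      then have "cinner (\<pi> (star s) (\<pi> s v)) v = 0" using orth range_N by blast
      then have "cinner (\<pi> s v) (\<pi> s v) = 0" by (simp add: \<pi>_adj star_star)
      then show "\<pi> s v = 0" by (simp add: cinner_self_eq_zero)
    qed
  qed
  obtain Q where Q: "Q \<in> bounded_operators" "\<And>v. Q v \<in> N" "\<And>v n. n \<in> N \<Longrightarrow> cinner n (v - Q v) = 0"
    "\<And>v w. cinner (Q v) w = cinner v (Q w)" and unique: "\<And>v m. m \<in> N \<Longrightarrow> \<forall>n\<in>N. cinner n (v - m) = 0 \<Longrightarrow> Q v = m"
    using orthogonal_projection_operator[OF N] by blast
  have \<pi>_M: "\<pi> x \<in> M" for x using bij by (auto simp: bij_betw_def)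
  have "Q \<circ> T = T \<circ> Q" if T: "T \<in> commutant M" for T
  proof
    fix v
    have lin: "bounded_linear T" and T_scale: "\<And>c v. T (scaleC c v) = scaleC c (T v)"
      and comm: "\<And>x v. T (\<pi> x v) = \<pi> x (T v)"
      using T \<pi>_M unfolding commutant_def bounded_operators_def fun_eq_iff by auto
    interpret T: bounded_linear T by (rule lin)
    have TN: "T n \<in> N" if n: "n \<in> N" for n
      unfolding N_def
    proof
      fix A assume A: "A \<in> L"
      then have sub: "closed_complex_subspace A" and contains: "\<And>s w. s \<in> S \<Longrightarrow> \<pi> (star s) w \<in> A"
        unfolding L_def by auto
      have "closed (T -` A)"
        using sub continuous_closed_vimage[of A T] lin unfolding closed_complex_subspace_def
        by (simp add: linear_continuous_at)
      then have "closed_complex_subspace (T -` A)"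
        using sub unfolding closed_complex_subspace_def by (simp add: T.add T.zero T_scale)
      moreover have "\<pi> (star s) w \<in> T -` A" if "s \<in> S" for s w using contains[OF that] comm by simp
      ultimately have "T -` A \<in> L" unfolding L_def by blast
      then show "T n \<in> A" using n unfolding N_def by blast
    qed
    have "\<pi> s (v - Q v) = 0" if "s \<in> S" for s using kernel[of "v - Q v"] Q(3) that by blast
    then have "\<pi> s (T (v - Q v)) = 0" if "s \<in> S" for s using that by (simp add: T.zero flip: comm)
    then have "\<forall>n\<in>N. cinner n (T (v - Q v)) = 0" using kernel by blast
    then have "\<forall>n\<in>N. cinner n (T v - T (Q v)) = 0" by (simp add: T.diff)
    then have "Q (T v) = T (Q v)" by (rule unique[OF TN[OF Q(2)]])
    then show "(Q \<circ> T) v = (T \<circ> Q) v" by simp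
  qed
  then have "Q \<in> commutant (commutant M)"
    using Q(1) unfolding commutant_def[of "commutant M"] by blast
  then have "Q \<in> M" using M unfolding von_neumann_algebra_on_def by simp
  then obtain a where a: "\<pi> a = Q" using bij by (auto simp: bij_betw_def)
  have "star a = a"
  proof (rule \<pi>_inj)
    fix w
    have "cinner v (\<pi> (star a) w - \<pi> a w) = 0" for v
      using \<pi>_adj[of a v w] Q(4)[of v w] by (simp add: a cinner_diff_right)
    then have "\<pi> (star a) w - \<pi> a w = 0" using cinner_self_eq_zero by blast
    then show "\<pi> (star a) w = \<pi> a w" by simp
  qed
  moreover have "Q (Q v) = Q v" for v by (rule unique[OF Q(2)]) simp
  then have "a * a = a" by (intro \<pi>_inj) (simp add: \<pi>_mult a)
  ultimately have pa: "projection a" by (simp add: projection_def)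
  have ann: "x \<in> right_annihilator S \<longleftrightarrow> a * x = 0" for x
  proof -
    have zero: "y * x = 0 \<longleftrightarrow> (\<forall>v. \<pi> y (\<pi> x v) = 0)" for y
    proof
      assume "\<forall>v. \<pi> y (\<pi> x v) = 0"
      then show "y * x = 0" by (intro \<pi>_inj) (simp add: \<pi>_mult \<pi>_zero)
    qed (simp add: \<pi>_zero flip: \<pi>_mult)
    have Q_zero: "Q u = 0 \<longleftrightarrow> (\<forall>n\<in>N. cinner n u = 0)" for u
    proof
      assume "Q u = 0"
      then show "\<forall>n\<in>N. cinner n u = 0" using Q(3)[of _ u] by simp
    next
      assume "\<forall>n\<in>N. cinner n u = 0"
      then show "Q u = 0" using N unfolding closed_complex_subspace_def by (intro unique) simp_all
    qed
    have "x \<in> right_annihilator S \<longleftrightarrow> (\<forall>v. \<forall>s\<in>S. \<pi> s (\<pi> x v) = 0)"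
      unfolding right_annihilator_def using zero by auto
    also have "\<dots> \<longleftrightarrow> (\<forall>v. Q (\<pi> x v) = 0)" unfolding kernel Q_zero ..
    also have "\<dots> \<longleftrightarrow> a * x = 0" unfolding zero a ..
    finally show ?thesis .
  qed
  have "right_annihilator S = range (\<lambda>x. (1 - a) * x)"
  proof (intro set_eqI iffI)
    fix x assume "x \<in> right_annihilator S"
    then have "(1 - a) * x = x" unfolding ann by (simp add: left_diff_distrib)
    then show "x \<in> range (\<lambda>x. (1 - a) * x)" by (intro range_eqI[of _ _ x]) simp
  next
    fix x assume "x \<in> range (\<lambda>x. (1 - a) * x)"
    then obtain y where "x = (1 - a) * y" by blast
    then show "x \<in> right_annihilator S"
      unfolding ann by (simp add: left_diff_distrib right_diff_distrib projection_idem_left[OF pa])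
  qed
  then show "\<exists>p. projection p \<and> right_annihilator S = range (\<lambda>x. p * x)"
    using projection_complement[OF pa] by blast
qed

theorem corollary13:
  "(aw_star_algebra TYPE('a::cstar_algebra) \<and> type_I_f TYPE('a) \<longrightarrow>
      almost_star_clean TYPE('a) \<and>
      (von_neumann_regular TYPE('a) \<longrightarrow> star_clean TYPE('a))) \<and>
   (von_neumann_algebra TYPE('h::complex_hilbert_space) TYPE('a) \<and> type_I_f TYPE('a) \<longrightarrow>
      almost_star_clean TYPE('a) \<and>
      (von_neumann_regular TYPE('a) \<longrightarrow> star_clean TYPE('a)))"
proof -
  have clean: "almost_star_clean TYPE('a) \<and> (von_neumann_regular TYPE('a) \<longrightarrow> star_clean TYPE('a))"
    if "aw_star_algebra TYPE('a)" "type_I_f TYPE('a)"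
    using aw_star_type_I_f_almost_star_clean[OF that] von_neumann_regular_imp_star_clean by blast
  have "aw_star_algebra TYPE('a)" if "von_neumann_algebra TYPE('h) TYPE('a)"
    unfolding aw_star_algebra_def by (rule von_neumann_algebra_baer[OF that])
  with clean show ?thesis by blast
qed

end
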